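(* Let $T$ be the Thompson group $T$, let $C,D\in T$ be the two elements given (as homeomorphisms of $\mathbb{R}/\mathbb{Z}$) by $$C(t)=\begin{cases} \tfrac t2+\tfrac34, & 0\le t\le \tfrac12,\\ 2t-1, & \tfrac12\le t\le\tfrac34,\\ t-\tfrac14, & \tfrac34\le t\le 1,\end{cases}\qquad D(t)=t-\tfrac14 \pmod 1,$$ and let $I$ denote the unit element of $T$. Then $$\sqrt2+\sqrt3\;<\;\frac1{\sqrt{12}}\,\bigl\|(I+C+C^2)(I+D+D^2+D^3)\bigr\|\;\le\; 2+\sqrt2 .$$ Moreover, if the Thompson group $F=\{f\in T\mid f(0)=0\}$ is amenable, then the upper bound is attained, i.e. $\frac1{\sqrt{12}}\|(I+C+C^2)(I+D+D^2+D^3)\|=2+\sqrt2$.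
   Context: The Thompson group $T$ is the group, under composition, of (cyclic) order preserving homeomorphisms $f:\mathbb{R}/\mathbb{Z}\to\mathbb{R}/\mathbb{Z}$ such that $f$ and $f^{-1}$ are piecewise linear with finitely many breakpoints, all breakpoints of $f$ and $f^{-1}$ lie in $\mathbb{Z}[\tfrac12]/\mathbb{Z}$, and all slopes of $f$ lie in $\{2^n\mid n\in\mathbb{Z}\}$. The elements $C$ (of order 3) and $D$ (of order 4) generate $T$. For a discrete group $\Gamma$ and an element $a$ of the group ring $\mathbb{C}\Gamma$, $\|a\|$ denotes the operator norm $\|\lambda(a)\|_{B(\ell^2(\Gamma))}$, where $\lambda$ is the left regular representation of $\Gamma$ (extended linearly to $\mathbb{C}\Gamma$). A discrete group $\Gamma$ is amenable if there is a finitely additive measure $\mu$ defined on all subsets of $\Gamma$, with values in $[0,1]$, $\mu(\Gamma)=1$, and $\mu(xA)=\mu(A)$ for all $A\subset\Gamma$ and $x\in\Gamma$. *)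

theory Defs
  imports "HOL-Analysis.Analysis" "HOL-Algebra.Coset" "HOL-Algebra.Ring"
begin

quotient_type circle = real / "\<lambda>x y :: real. x - y \<in> \<int>"
  morphisms circle_rep circ
proof (rule equivpI)
  show "reflp (\<lambda>x y :: real. x - y \<in> \<int>)"
    by (auto simp: reflp_def)
  show "symp (\<lambda>x y :: real. x - y \<in> \<int>)"
    by (auto simp: symp_def) (metis Ints_minus minus_diff_eq)
  show "transp (\<lambda>x y :: real. x - y \<in> \<int>)"
    by (auto simp: transp_def) (metis Ints_add diff_add_cancel add_diff_eq)
qed

lemma circ_eq_iff: "circ x = circ y \<longleftrightarrow> x - y \<in> \<int>"
  by (fact circle.abs_eq_iff)

instantiation circle :: topological_space
begin

definition open_circle :: "circle set \<Rightarrow> bool" where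
  "open_circle U \<longleftrightarrow> open (circ -` U)"

instance
  by standard (auto simp: open_circle_def vimage_Union)

end

text \<open>\<open>cyclically_ordered p q r\<close>: the points are distinct and, going once around the circle
  in the positive direction starting from \<open>p\<close>, one meets \<open>q\<close> before \<open>r\<close>.\<close>

definition cyclically_ordered :: "circle \<Rightarrow> circle \<Rightarrow> circle \<Rightarrow> bool" where
  "cyclically_ordered p q r \<longleftrightarrow>
     (\<exists>x y z. p = circ x \<and> q = circ y \<and> r = circ z \<and> x < y \<and> y < z \<and> z < x + 1)"

definition dyadic_points :: "circle set" where
  "dyadic_points = {circ (of_int k / 2 ^ n) | (k :: int) (n :: nat). True}"

text \<open>In local coordinates lifted to \<open>\<real>\<close>, the map \<open>f\<close> is affine with slope \<open>s\<close> in a full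
  (two-sided) neighbourhood of \<open>p\<close>.\<close>

definition affine_at :: "(circle \<Rightarrow> circle) \<Rightarrow> circle \<Rightarrow> real \<Rightarrow> bool" where
  "affine_at f p s \<longleftrightarrow>
     (\<exists>x y. p = circ x \<and> (\<forall>\<^sub>F t in nhds x. f (circ t) = circ (y + s * (t - x))))"

definition breakpoints :: "(circle \<Rightarrow> circle) \<Rightarrow> circle set" where
  "breakpoints f = {p. \<nexists>s. affine_at f p s}"

text \<open>A homeomorphism with finitely many breakpoints is affine on each of the finitely many arcs
  between them, i.e. it is piecewise linear.

  The condition on the dyadic points follows from the remaining ones unless \<open>f\<close> has no breakpoints
  at all, that is, unless \<open>f\<close> is a rotation. Without it, all rotations would be
  admitted, also those by non-dyadic angles, and the elements would not be closed under
  composition.\<close>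

definition thompson_T :: "(circle \<Rightarrow> circle) monoid" where
  "thompson_T =
     \<lparr>carrier = {f.
        homeomorphism UNIV UNIV f (inv_into UNIV f) \<and>
        (\<forall>p q r. cyclically_ordered p q r \<longrightarrow> cyclically_ordered (f p) (f q) (f r)) \<and>
        finite (breakpoints f) \<and> finite (breakpoints (inv_into UNIV f)) \<and>
        breakpoints f \<subseteq> dyadic_points \<and> breakpoints (inv_into UNIV f) \<subseteq> dyadic_points \<and>
        (\<forall>p s. affine_at f p s \<longrightarrow> (\<exists>n :: int. s = 2 powi n)) \<and>
        f ` dyadic_points = dyadic_points},
      monoid.mult = (\<circ>),
      one = id\<rparr>"

definition thompson_F :: "(circle \<Rightarrow> circle) monoid" where
  "thompson_F = thompson_T\<lparr>carrier := {f \<in> carrier thompson_T. f (circ 0) = circ 0}\<rparr>"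

lift_definition thompson_C :: "circle \<Rightarrow> circle" is
  "\<lambda>x. let t = frac x in
     if t \<le> 1/2 then t / 2 + 3/4 else if t \<le> 3/4 then 2 * t - 1 else t - 1/4"
proof -
  fix x y :: real
  assume "x - y \<in> \<int>"
  then have "frac x = frac y"
    by (metis frac_diff_zero frac_eq_0_iff)
  then show "?thesis x y"
    by simp
qed

lift_definition thompson_D :: "circle \<Rightarrow> circle" is "\<lambda>x. x - 1/4"
  by simp

lemma thompson_C_circ:
  "0 \<le> t \<Longrightarrow> t \<le> 1/2 \<Longrightarrow> thompson_C (circ t) = circ (t / 2 + 3/4)"
  "1/2 \<le> t \<Longrightarrow> t \<le> 3/4 \<Longrightarrow> thompson_C (circ t) = circ (2 * t - 1)"
  "3/4 \<le> t \<Longrightarrow> t \<le> 1 \<Longrightarrow> thompson_C (circ t) = circ (t - 1/4)"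
proof -
  show "thompson_C (circ t) = circ (t / 2 + 3/4)" if "0 \<le> t" "t \<le> 1/2"
    using that frac_eq[of t] by (simp add: thompson_C.abs_eq)
  show "thompson_C (circ t) = circ (2 * t - 1)" if "1/2 \<le> t" "t \<le> 3/4"
  proof (cases "t = 1/2")
    case True
    then show ?thesis
      unfolding True thompson_C.abs_eq circ_eq_iff by (simp add: frac_eq_id)
  next
    case False
    then show ?thesis
      using that frac_eq[of t] by (simp add: thompson_C.abs_eq)
  qed
  show "thompson_C (circ t) = circ (t - 1/4)" if "3/4 \<le> t" "t \<le> 1"
  proof (cases "t = 1")
    case True
    then show ?thesis
      unfolding True thompson_C.abs_eq circ_eq_iff by simp
  next
    case False
    then show ?thesis
      using that frac_eq[of t] by (auto simp: thompson_C.abs_eq intro!: arg_cong[of _ _ circ])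
  qed
qed

lemma thompson_D_circ: "thompson_D (circ t) = circ (t - 1/4)"
  by (fact thompson_D.abs_eq)

text \<open>The elements of the group ring are the finitely supported complex functions on the group,
  extended by \<open>0\<close> outside of the carrier.\<close>

definition group_ring :: "('a, 'b) monoid_scheme \<Rightarrow> ('a \<Rightarrow> complex) ring" where
  "group_ring G =
     \<lparr>carrier = {a. finite {g. a g \<noteq> 0} \<and> {g. a g \<noteq> 0} \<subseteq> carrier G},
      monoid.mult = (\<lambda>a b x. \<Sum>(g, h) | a g \<noteq> 0 \<and> b h \<noteq> 0 \<and> g \<otimes>\<^bsub>G\<^esub> h = x. a g * b h),
      one = (\<lambda>x. if x = \<one>\<^bsub>G\<^esub> then 1 else 0),
      zero = (\<lambda>x. 0),
      add = (\<lambda>a b x. a x + b x)\<rparr>"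

definition group_elt :: "'a \<Rightarrow> 'a \<Rightarrow> complex" where
  "group_elt g = (\<lambda>x. if x = g then 1 else 0)"

definition ell2 :: "('a, 'b) monoid_scheme \<Rightarrow> ('a \<Rightarrow> complex) set" where
  "ell2 G = {\<xi>. (\<forall>x. x \<notin> carrier G \<longrightarrow> \<xi> x = 0) \<and> (\<lambda>x. (cmod (\<xi> x))\<^sup>2) summable_on carrier G}"

definition ell2_norm :: "('a, 'b) monoid_scheme \<Rightarrow> ('a \<Rightarrow> complex) \<Rightarrow> real" where
  "ell2_norm G \<xi> = sqrt (\<Sum>\<^sub>\<infinity>x\<in>carrier G. (cmod (\<xi> x))\<^sup>2)"

definition left_regular :: "('a, 'b) monoid_scheme \<Rightarrow> 'a \<Rightarrow> ('a \<Rightarrow> complex) \<Rightarrow> 'a \<Rightarrow> complex" where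
  "left_regular G g \<xi> = (\<lambda>x. if x \<in> carrier G then \<xi> (inv\<^bsub>G\<^esub> g \<otimes>\<^bsub>G\<^esub> x) else 0)"

definition left_regular_lin ::
  "('a, 'b) monoid_scheme \<Rightarrow> ('a \<Rightarrow> complex) \<Rightarrow> ('a \<Rightarrow> complex) \<Rightarrow> 'a \<Rightarrow> complex" where
  "left_regular_lin G a \<xi> = (\<lambda>x. \<Sum>g | a g \<noteq> 0. a g * left_regular G g \<xi> x)"

text \<open>The supremum is taken in the reals, so it is meaningful for bounded operators only. Every
  \<open>left_regular_lin G a\<close> with \<open>G\<close> a group and \<open>a\<close> in its group ring is bounded,
  namely by the sum of the absolute values of the coefficients of \<open>a\<close>.\<close>

definition ell2_opnorm ::
  "('a, 'b) monoid_scheme \<Rightarrow> (('a \<Rightarrow> complex) \<Rightarrow> 'a \<Rightarrow> complex) \<Rightarrow> real" where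
  "ell2_opnorm G A = (SUP \<xi>\<in>{\<xi> \<in> ell2 G. ell2_norm G \<xi> \<le> 1}. ell2_norm G (A \<xi>))"

definition group_ring_norm :: "('a, 'b) monoid_scheme \<Rightarrow> ('a \<Rightarrow> complex) \<Rightarrow> real" where
  "group_ring_norm G a = ell2_opnorm G (left_regular_lin G a)"

definition amenable :: "('a, 'b) monoid_scheme \<Rightarrow> bool" where
  "amenable G \<longleftrightarrow>
     (\<exists>\<mu> :: 'a set \<Rightarrow> real.
        (\<forall>A. A \<subseteq> carrier G \<longrightarrow> \<mu> A \<in> {0..1}) \<and>
        additive (Pow (carrier G)) \<mu> \<and>
        \<mu> (carrier G) = 1 \<and>
        (\<forall>x\<in>carrier G. \<forall>A. A \<subseteq> carrier G \<longrightarrow> \<mu> (x <#\<^bsub>G\<^esub> A) = \<mu> A))"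

end

theory Submission
  imports Defs
begin

text \<open>
Let \<open>A = {1, C, C\<^sup>2}\<close> and \<open>B = {1, D, D\<^sup>2, D\<^sup>3}\<close>. The elements \<open>x\<close> of \<open>T\<close> are the edges of a
bipartite graph with vertices the right cosets of \<open>A\<close> and of \<open>B\<close>, where \<open>x\<close> joins \<open>A x\<close> to \<open>B x\<close>.
The norm of the product of the two coset sums, divided by \<open>sqrt 12\<close>, is the norm of the adjacency
operator of this graph. It is computed by means of \<^emph>\<open>edge weights\<close>: functions \<open>R > 0\<close> on \<open>T\<close> with
\<open>\<Sum>a\<in>A. 1 / R (a x) \<le> \<rho>\<close> and \<open>\<Sum>b\<in>B. R (b x) \<le> \<rho>\<close> for all \<open>x\<close>.

By the Schur test an edge weight for \<open>\<rho>\<close> bounds the norm by \<open>sqrt 12 * \<rho>\<close> (\<open>prod_norm_le\<close>).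
Conversely, if the norm is below \<open>sqrt 12 * \<rho>\<close>, the resolvent of the random walk on the graph,
applied to the indicator function of a vertex, provides positive superharmonic functions \<open>\<phi>\<close> on the
cosets of \<open>A\<close> and \<open>\<psi>\<close> on those of \<open>B\<close> (\<open>superharmonic_pair_exists\<close>), and \<open>\<phi> / \<psi>\<close> is an edge weight for \<open>\<rho>\<close>. All claims thus
become claims about the possible values of \<open>\<rho>\<close>.

\<^item> \<open>\<rho> = 2 + sqrt 2\<close> is possible: let \<open>R x\<close> be \<open>1 / sqrt 2\<close> or \<open>1\<close>, according to whether \<open>x(0)\<close> lies in
  \<open>[0, 1/2)\<close> or in \<open>[1/2, 1)\<close> (\<open>half_weight_edge_weight\<close>).

\<^item> Values near \<open>sqrt 2 + sqrt 3\<close> are impossible for weights \<open>\<phi> / \<psi>\<close>. This is the value for the free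
  product of \<open>A\<close> and \<open>B\<close>, whose graph is a tree. Start where \<open>\<phi> / \<psi>\<close> is almost maximal; if \<open>\<rho>\<close> is close to
  \<open>sqrt 2 + sqrt 3\<close>, then \<open>\<psi>\<close> has to decrease along every reduced word of bounded length. The relation
  \<open>(C D)\<^sup>5 = 1\<close> closes such a word to a loop, which is absurd (\<open>prod_norm_gt_of_relation\<close>).

\<^item> If \<open>F\<close> is amenable, an edge weight may be averaged over \<open>F\<close> from the right
  (\<open>edge_weight_average\<close>), after which it depends on \<open>x(0)\<close> only. As \<open>C\<close> and \<open>D\<close> agree on \<open>[3/4, 1]\<close>,
  some edges become parallel in the quotient of the graph by \<open>F\<close>. If \<open>\<rho> < 2 + sqrt 2\<close>, then \<open>R x + R (D x)\<close> can be
  increased by a fixed amount again and again, although it is at most \<open>\<rho>\<close>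
  (\<open>F_invariant_edge_weight_ge\<close>).
\<close>

section \<open>Sums over the cosets of a finite subgroup\<close>

definition orbit_sum ::
  "('a, 'b) monoid_scheme \<Rightarrow> 'a set \<Rightarrow> ('a \<Rightarrow> 'c::comm_monoid_add) \<Rightarrow> 'a \<Rightarrow> 'c" where
  "orbit_sum G S f x = (\<Sum>s\<in>S. f (s \<otimes>\<^bsub>G\<^esub> x))"

lemma has_sum_sum:
  fixes f :: "'i \<Rightarrow> 'a \<Rightarrow> real"
  assumes "\<And>i. i \<in> I \<Longrightarrow> (f i has_sum s i) X"
  shows "((\<lambda>x. \<Sum>i\<in>I. f i x) has_sum (\<Sum>i\<in>I. s i)) X"
  using assms by (induction I rule: infinite_finite_induct) (auto intro: has_sum_add)

locale finite_subgroup = group G + sub: subgroup S G for G (structure) and S +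
  assumes finite_S: "finite S"
begin

lemma one_mem: "\<one> \<in> S"
  by (rule sub.one_closed)

lemma card_pos: "0 < card S"
  using finite_S one_mem card_gt_0_iff by blast

lemma in_carrier: "s \<in> S \<Longrightarrow> s \<in> carrier G"
  using sub.subset by blast

lemma bij_translate: "g \<in> carrier G \<Longrightarrow> bij_betw (\<lambda>x. g \<otimes> x) (carrier G) (carrier G)"
  by (rule bij_betw_byWitness[where f' = "\<lambda>x. inv g \<otimes> x"])
     (auto simp: m_assoc[symmetric])

lemma bij_inv: "bij_betw (\<lambda>s. inv s) S S"
  by (rule bij_betw_byWitness[where f' = "\<lambda>s. inv s"]) (auto simp: in_carrier)

lemma orbit_sum_translate:
  assumes "s \<in> S" "x \<in> carrier G"
  shows "orbit_sum G S f (s \<otimes> x) = orbit_sum G S f x"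
proof -
  have "bij_betw (\<lambda>t. t \<otimes> s) S S"
    by (rule bij_betw_byWitness[where f' = "\<lambda>t. t \<otimes> inv s"])
       (use assms in \<open>auto simp: in_carrier m_assoc\<close>)
  then have "(\<Sum>t\<in>S. f ((t \<otimes> s) \<otimes> x)) = (\<Sum>t\<in>S. f (t \<otimes> x))"
    by (rule sum.reindex_bij_betw[where g = "\<lambda>t. f (t \<otimes> x)"])
  then show ?thesis
    using assms by (simp add: orbit_sum_def m_assoc in_carrier)
qed

lemma orbit_sum_inv: "orbit_sum G S f x = (\<Sum>s\<in>S. f (inv s \<otimes> x))"
  unfolding orbit_sum_def
  by (rule sum.reindex_bij_betw[OF bij_inv, where g = "\<lambda>s. f (s \<otimes> x)", symmetric])

lemma orbit_sum_invariant:
  fixes f :: "'a \<Rightarrow> real"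
  assumes "\<And>s. s \<in> S \<Longrightarrow> f (s \<otimes> x) = f x"
  shows "orbit_sum G S f x = real (card S) * f x"
  using assms by (simp add: orbit_sum_def)

lemma orbit_sum_ge:
  fixes f :: "'a \<Rightarrow> real"
  assumes "\<And>y. y \<in> carrier G \<Longrightarrow> 0 \<le> f y" "x \<in> carrier G" "s \<in> S"
  shows "f (s \<otimes> x) \<le> orbit_sum G S f x"
  unfolding orbit_sum_def
  by (rule member_le_sum) (use assms finite_S in \<open>auto simp: in_carrier\<close>)

lemma orbit_sum_ge_self:
  fixes f :: "'a \<Rightarrow> real"
  assumes "\<And>y. y \<in> carrier G \<Longrightarrow> 0 \<le> f y" "x \<in> carrier G"
  shows "f x \<le> orbit_sum G S f x"
  using orbit_sum_ge[OF assms one_mem] assms by simp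

lemma orbit_sum_nonneg:
  fixes f :: "'a \<Rightarrow> real"
  assumes "\<And>y. y \<in> carrier G \<Longrightarrow> 0 \<le> f y" "x \<in> carrier G"
  shows "0 \<le> orbit_sum G S f x"
  unfolding orbit_sum_def by (rule sum_nonneg) (use assms in \<open>auto simp: in_carrier\<close>)

lemma has_sum_orbit_sum:
  fixes f :: "'a \<Rightarrow> real"
  assumes "f summable_on carrier G"
  shows "(orbit_sum G S f has_sum real (card S) * infsum f (carrier G)) (carrier G)"
proof -
  have "((\<lambda>x. \<Sum>s\<in>S. f (s \<otimes> x)) has_sum (\<Sum>s\<in>S. infsum f (carrier G))) (carrier G)"
    using assms
    by (intro has_sum_sum has_sum_reindex_bij_betw[OF bij_translate, THEN iffD2])
       (auto simp: in_carrier)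
  then show ?thesis
    by (simp add: orbit_sum_def[abs_def])
qed

lemma finite_support_translate:
  fixes f :: "'a \<Rightarrow> real"
  assumes "finite {x \<in> carrier G. f x \<noteq> 0}" "s \<in> S"
  shows "finite {x \<in> carrier G. f (s \<otimes> x) \<noteq> 0}"
proof (rule finite_subset)
  show "{x \<in> carrier G. f (s \<otimes> x) \<noteq> 0} \<subseteq> (\<lambda>y. inv s \<otimes> y) ` {x \<in> carrier G. f x \<noteq> 0}"
  proof
    fix x assume x: "x \<in> {x \<in> carrier G. f (s \<otimes> x) \<noteq> 0}"
    then have "x = inv s \<otimes> (s \<otimes> x)"
      using assms by (simp add: m_assoc[symmetric] in_carrier)
    then show "x \<in> (\<lambda>y. inv s \<otimes> y) ` {x \<in> carrier G. f x \<noteq> 0}"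
      using x assms by (auto simp: in_carrier)
  qed
qed (use assms in simp)

lemma finite_support_orbit_sum:
  fixes f :: "'a \<Rightarrow> real"
  assumes "finite {x \<in> carrier G. f x \<noteq> 0}"
  shows "finite {x \<in> carrier G. orbit_sum G S f x \<noteq> 0}"
proof (rule finite_subset)
  show "{x \<in> carrier G. orbit_sum G S f x \<noteq> 0} \<subseteq> (\<Union>s\<in>S. {x \<in> carrier G. f (s \<otimes> x) \<noteq> 0})"
    by (auto simp: orbit_sum_def elim: sum.not_neutral_contains_not_neutral)
qed (use finite_S finite_support_translate[OF assms] in auto)

text \<open>Translation by \<open>s\<close> has adjoint translation by \<open>inv s\<close>, and
  \<open>S\<close> is closed under inverses. One finitely supported argument makes all sums finite.\<close>

lemma orbit_sum_self_adjoint: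
  fixes f g :: "'a \<Rightarrow> real"
  assumes "finite {x \<in> carrier G. f x \<noteq> 0}"
  shows "(\<Sum>\<^sub>\<infinity>x\<in>carrier G. orbit_sum G S f x * g x) = (\<Sum>\<^sub>\<infinity>x\<in>carrier G. f x * orbit_sum G S g x)"
proof -
  have fs: "(\<lambda>x. f (s \<otimes> x) * g x) summable_on carrier G" if "s \<in> S" for s
    by (rule finite_nonzero_values_imp_summable_on)
       (rule finite_subset[OF _ finite_support_translate[OF assms that]], auto)
  have fs': "(\<lambda>x. f x * g (s \<otimes> x)) summable_on carrier G" for s
    by (rule finite_nonzero_values_imp_summable_on) (rule finite_subset[OF _ assms], auto)
  have shift: "(\<Sum>\<^sub>\<infinity>x\<in>carrier G. f (s \<otimes> x) * g x) = (\<Sum>\<^sub>\<infinity>x\<in>carrier G. f x * g (inv s \<otimes> x))"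
    if s: "s \<in> S" for s
  proof -
    have "(\<Sum>\<^sub>\<infinity>x\<in>carrier G. f x * g (inv s \<otimes> x))
        = (\<Sum>\<^sub>\<infinity>x\<in>carrier G. f (s \<otimes> x) * g (inv s \<otimes> (s \<otimes> x)))"
      by (rule infsum_reindex_bij_betw[OF bij_translate, symmetric]) (use s in_carrier in auto)
    also have "\<dots> = (\<Sum>\<^sub>\<infinity>x\<in>carrier G. f (s \<otimes> x) * g x)"
      by (rule infsum_cong) (use s in \<open>simp add: m_assoc[symmetric] in_carrier\<close>)
    finally show ?thesis ..
  qed
  have "(\<Sum>\<^sub>\<infinity>x\<in>carrier G. orbit_sum G S f x * g x)
      = (\<Sum>s\<in>S. \<Sum>\<^sub>\<infinity>x\<in>carrier G. f (s \<otimes> x) * g x)"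
    unfolding orbit_sum_def sum_distrib_right
    by (rule infsumI, rule has_sum_sum) (use fs in auto)
  also have "\<dots> = (\<Sum>s\<in>S. \<Sum>\<^sub>\<infinity>x\<in>carrier G. f x * g (inv s \<otimes> x))"
    by (intro sum.cong refl shift)
  also have "\<dots> = (\<Sum>\<^sub>\<infinity>x\<in>carrier G. f x * orbit_sum G S g x)"
    unfolding orbit_sum_inv sum_distrib_left
    by (rule infsumI[symmetric], rule has_sum_sum) (use fs' in auto)
  finally show ?thesis .
qed

end

section \<open>Edge weights bound the norm from above\<close>

text \<open>The element \<open>x\<close> is the edge between the cosets \<open>A x\<close> and
  \<open>B x\<close>. For positive functions \<open>\<phi>\<close> on the cosets of \<open>A\<close> and
  \<open>\<psi>\<close> on those of \<open>B\<close>, the quotient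
  \<open>R x = \<phi> (A x) / \<psi> (B x)\<close> satisfies these inequalities exactly if the sum of the values
  at the neighbours of a vertex is at most \<open>\<rho>\<close> times the value at the vertex. Averaging over a
  subgroup preserves the inequalities, but not the form of a quotient.\<close>

definition edge_weight ::
  "('a, 'b) monoid_scheme \<Rightarrow> 'a set \<Rightarrow> 'a set \<Rightarrow> real \<Rightarrow> ('a \<Rightarrow> real) \<Rightarrow> bool" where
  "edge_weight G A B \<rho> R \<longleftrightarrow>
     (\<forall>x\<in>carrier G. 0 < R x \<and> orbit_sum G A (\<lambda>y. 1 / R y) x \<le> \<rho> \<and> orbit_sum G B R x \<le> \<rho>)"

definition set_elt :: "'a set \<Rightarrow> 'a \<Rightarrow> complex" where
  "set_elt S = (\<lambda>x. if x \<in> S then 1 else 0)"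

lemma set_elt_nonzero [simp]: "set_elt S x \<noteq> 0 \<longleftrightarrow> x \<in> S"
  by (simp add: set_elt_def)

text \<open>The Cauchy-Schwarz inequality for the splitting
  \<open>f i = (1 / sqrt (r i)) * (sqrt (r i) * f i)\<close>.\<close>

lemma weighted_sum_square_le:
  fixes f r :: "'i \<Rightarrow> real"
  assumes "\<And>i. i \<in> I \<Longrightarrow> 0 < r i" "(\<Sum>i\<in>I. 1 / r i) \<le> \<rho>"
  shows "(\<Sum>i\<in>I. f i)\<^sup>2 \<le> \<rho> * (\<Sum>i\<in>I. r i * (f i)\<^sup>2)"
proof -
  have "(\<Sum>i\<in>I. f i)\<^sup>2 = (\<Sum>i\<in>I. (1 / sqrt (r i)) * (sqrt (r i) * f i))\<^sup>2"
    using assms(1) by (intro arg_cong[where f = "\<lambda>x. x\<^sup>2"] sum.cong) fastforce+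
  also have "\<dots> \<le> (\<Sum>i\<in>I. (1 / sqrt (r i))\<^sup>2) * (\<Sum>i\<in>I. (sqrt (r i) * f i)\<^sup>2)"
    by (rule Cauchy_Schwarz_ineq_sum)
  also have "\<dots> = (\<Sum>i\<in>I. 1 / r i) * (\<Sum>i\<in>I. r i * (f i)\<^sup>2)"
    using assms(1) by (intro arg_cong2[where f = "(*)"] sum.cong)
      (auto simp: power_divide power_mult_distrib less_imp_le)
  also have "\<dots> \<le> \<rho> * (\<Sum>i\<in>I. r i * (f i)\<^sup>2)"
    using assms by (intro mult_right_mono sum_nonneg) (auto simp: less_imp_le)
  finally show ?thesis .
qed

locale finite_subgroup_pair = A: finite_subgroup G A + B: finite_subgroup G B
  for G (structure) and A B
begin

definition prod_norm :: real where
  "prod_norm = group_ring_norm G (set_elt A \<otimes>\<^bsub>group_ring G\<^esub> set_elt B)"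

text \<open>The left regular representation involves \<open>\<xi> (inv g \<otimes> x)\<close>; summing over a
  subgroup absorbs the inverse.\<close>

lemma left_regular_lin_set_elt_mult:
  "left_regular_lin G (set_elt A \<otimes>\<^bsub>group_ring G\<^esub> set_elt B) \<xi>
     = (\<lambda>x. if x \<in> carrier G then orbit_sum G A (orbit_sum G B \<xi>) x else 0)"
proof
  fix x
  define m where "m p = fst p \<otimes> snd p" for p :: "'a \<times> 'a"
  define a where "a = set_elt A \<otimes>\<^bsub>group_ring G\<^esub> set_elt B"
  have fin: "finite (A \<times> B)"
    using A.finite_S B.finite_S by simp
  have a: "a z = (\<Sum>p | p \<in> A \<times> B \<and> m p = z. 1)" for z
  proof -
    have "a z = (\<Sum>(g, h) | g \<in> A \<and> h \<in> B \<and> g \<otimes> h = z. set_elt A g * set_elt B h)"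
      by (simp add: a_def group_ring_def)
    also have "\<dots> = (\<Sum>p | p \<in> A \<times> B \<and> m p = z. 1)"
      by (rule sum.cong) (auto simp: m_def set_elt_def)
    finally show ?thesis .
  qed
  have supp: "{z. a z \<noteq> 0} = m ` (A \<times> B)"
  proof -
    have "a z \<noteq> 0 \<longleftrightarrow> z \<in> m ` (A \<times> B)" for z
    proof -
      have "finite {p. p \<in> A \<times> B \<and> m p = z}"
        by (rule finite_subset[OF _ fin]) auto
      then show ?thesis
        by (auto simp: a)
    qed
    then show ?thesis by blast
  qed
  have "left_regular_lin G a \<xi> x
      = (\<Sum>z\<in>m ` (A \<times> B). \<Sum>p | p \<in> A \<times> B \<and> m p = z. left_regular G (m p) \<xi> x)"
    unfolding left_regular_lin_def supp
    by (rule sum.cong, simp, subst a, subst sum_distrib_right, rule sum.cong) auto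
  also have "\<dots> = (\<Sum>p\<in>A \<times> B. left_regular G (m p) \<xi> x)"
    by (rule sum.image_gen[OF fin, symmetric])
  also have "\<dots> = (\<Sum>g\<in>A. \<Sum>h\<in>B. left_regular G (g \<otimes> h) \<xi> x)"
    by (simp add: sum.cartesian_product m_def case_prod_beta)
  also have "\<dots> = (if x \<in> carrier G then orbit_sum G A (orbit_sum G B \<xi>) x else 0)"
  proof (cases "x \<in> carrier G")
    case True
    have "(\<Sum>g\<in>A. \<Sum>h\<in>B. left_regular G (g \<otimes> h) \<xi> x)
        = (\<Sum>g\<in>A. \<Sum>h\<in>B. \<xi> (inv h \<otimes> (inv g \<otimes> x)))"
      using True
      by (intro sum.cong refl)
         (simp add: left_regular_def A.in_carrier B.in_carrier A.inv_mult_group A.m_assoc)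
    then show ?thesis
      using True by (simp add: A.orbit_sum_inv B.orbit_sum_inv)
  qed (simp add: left_regular_def)
  finally show "left_regular_lin G (set_elt A \<otimes>\<^bsub>group_ring G\<^esub> set_elt B) \<xi> x
    = (if x \<in> carrier G then orbit_sum G A (orbit_sum G B \<xi>) x else 0)"
    by (simp add: a_def)
qed

text \<open>The Schur test. Let \<open>\<zeta>\<close> be the sum of \<open>f\<close> over cosets of
  \<open>B\<close>. The condition on \<open>1 / R\<close> bounds the square of a sum of \<open>\<zeta>\<close>
  over a coset of \<open>A\<close> by \<open>\<rho>\<close> times a sum of \<open>R * \<zeta>\<^sup>2\<close>.
  Summed over the group this gives \<open>\<rho> * card A\<close> times the sum of
  \<open>R * \<zeta>\<^sup>2\<close>; since \<open>\<zeta>\<close> is constant on cosets of \<open>B\<close>,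
  there \<open>R\<close> may be replaced by its average over such a coset, which is at most
  \<open>\<rho> / card B\<close>.\<close>

lemma orbit_sum_square_summable:
  fixes f :: "'a \<Rightarrow> real"
  assumes R: "edge_weight G A B \<rho> R"
    and f: "(\<lambda>x. (f x)\<^sup>2) summable_on carrier G"
  shows "(\<lambda>x. (orbit_sum G A (orbit_sum G B f) x)\<^sup>2) summable_on carrier G"
    and "(\<Sum>\<^sub>\<infinity>x\<in>carrier G. (orbit_sum G A (orbit_sum G B f) x)\<^sup>2)
           \<le> \<rho>\<^sup>2 * card A * card B * (\<Sum>\<^sub>\<infinity>x\<in>carrier G. (f x)\<^sup>2)"
proof -
  define \<zeta> where "\<zeta> = orbit_sum G B f"
  define nA nB where "nA = real (card A)" and "nB = real (card B)"
  have nA: "0 < nA" and nB: "0 < nB"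
    using A.card_pos B.card_pos by (auto simp: nA_def nB_def)
  have pos: "0 < R x" and RA: "orbit_sum G A (\<lambda>y. 1 / R y) x \<le> \<rho>" and RB: "orbit_sum G B R x \<le> \<rho>"
    if "x \<in> carrier G" for x
    using R that by (auto simp: edge_weight_def)
  have R_le: "R x \<le> \<rho>" if "x \<in> carrier G" for x
    using order_trans[OF B.orbit_sum_ge_self RB] pos that by (metis less_imp_le)
  have \<rho>: "0 \<le> \<rho>"
    using pos[of \<one>] R_le[of \<one>] A.in_carrier[OF A.one_mem] by linarith
  have \<zeta>_sq: "(\<zeta> x)\<^sup>2 \<le> nB * orbit_sum G B (\<lambda>y. (f y)\<^sup>2) x" for x
    using weighted_sum_square_le[of B "\<lambda>_. 1" nB "\<lambda>b. f (b \<otimes> x)"]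
    by (simp add: \<zeta>_def orbit_sum_def nB_def)
  have f': "(orbit_sum G B (\<lambda>y. (f y)\<^sup>2) has_sum nB * (\<Sum>\<^sub>\<infinity>x\<in>carrier G. (f x)\<^sup>2)) (carrier G)"
    unfolding nB_def by (rule B.has_sum_orbit_sum[OF f])
  have \<zeta>: "(\<lambda>x. (\<zeta> x)\<^sup>2) summable_on carrier G"
    by (rule summable_on_comparison_test[OF summable_on_cmult_right[OF has_sum_imp_summable[OF f']]])
       (use \<zeta>_sq in auto)
  have \<zeta>_le: "(\<Sum>\<^sub>\<infinity>x\<in>carrier G. (\<zeta> x)\<^sup>2) \<le> nB * (nB * (\<Sum>\<^sub>\<infinity>x\<in>carrier G. (f x)\<^sup>2))"
    by (rule has_sum_mono[OF has_sum_infsum[OF \<zeta>] has_sum_cmult_right[OF f']]) (use \<zeta>_sq in auto)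
  define w where "w x = R x * (\<zeta> x)\<^sup>2" for x
  have w: "w summable_on carrier G"
    by (rule summable_on_comparison_test[OF summable_on_cmult_right[OF \<zeta>, of \<rho>]])
       (use R_le pos in \<open>auto simp: w_def mult_right_mono less_imp_le\<close>)
  have "(orbit_sum G B w has_sum nB * infsum w (carrier G)) (carrier G)"
    unfolding nB_def by (rule B.has_sum_orbit_sum[OF w])
  moreover have "orbit_sum G B w x \<le> \<rho> * (\<zeta> x)\<^sup>2" if x: "x \<in> carrier G" for x
  proof -
    have "orbit_sum G B w x = orbit_sum G B R x * (\<zeta> x)\<^sup>2"
      unfolding orbit_sum_def[of G B R] orbit_sum_def[of G B w] w_def sum_distrib_right
      by (rule sum.cong) (use x in \<open>auto simp: \<zeta>_def B.orbit_sum_translate\<close>)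
    then show ?thesis
      using RB[OF x] by (simp add: mult_right_mono)
  qed
  ultimately have w_le: "nB * infsum w (carrier G) \<le> \<rho> * (\<Sum>\<^sub>\<infinity>x\<in>carrier G. (\<zeta> x)\<^sup>2)"
    by (rule has_sum_mono[OF _ has_sum_cmult_right[OF has_sum_infsum[OF \<zeta>]]])
  have u: "(orbit_sum G A w has_sum nA * infsum w (carrier G)) (carrier G)"
    unfolding nA_def by (rule A.has_sum_orbit_sum[OF w])
  have u_le: "(orbit_sum G A \<zeta> x)\<^sup>2 \<le> \<rho> * orbit_sum G A w x" if x: "x \<in> carrier G" for x
    using weighted_sum_square_le[of A "\<lambda>a. R (a \<otimes> x)" \<rho> "\<lambda>a. \<zeta> (a \<otimes> x)"] RA[OF x] pos x
    by (simp add: orbit_sum_def w_def A.in_carrier)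
  show *: "(\<lambda>x. (orbit_sum G A (orbit_sum G B f) x)\<^sup>2) summable_on carrier G"
    unfolding \<zeta>_def[symmetric]
    by (rule summable_on_comparison_test[OF summable_on_cmult_right[OF has_sum_imp_summable[OF u], of \<rho>]])
       (use u_le in auto)
  have "(\<Sum>\<^sub>\<infinity>x\<in>carrier G. (orbit_sum G A \<zeta> x)\<^sup>2) \<le> \<rho> * (nA * infsum w (carrier G))"
    by (rule has_sum_mono[OF has_sum_infsum[OF *[folded \<zeta>_def]] has_sum_cmult_right[OF u]])
       (use u_le in auto)
  also have "\<dots> = \<rho> * nA / nB * (nB * infsum w (carrier G))"
    using nB by simp
  also have "\<dots> \<le> \<rho> * nA / nB * (\<rho> * (nB * (nB * (\<Sum>\<^sub>\<infinity>x\<in>carrier G. (f x)\<^sup>2))))"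
    using \<rho> nA nB by (intro mult_left_mono order_trans[OF w_le] \<zeta>_le) auto
  also have "\<dots> = \<rho>\<^sup>2 * nA * nB * (\<Sum>\<^sub>\<infinity>x\<in>carrier G. (f x)\<^sup>2)"
    using nB by (simp add: power2_eq_square)
  finally show "(\<Sum>\<^sub>\<infinity>x\<in>carrier G. (orbit_sum G A (orbit_sum G B f) x)\<^sup>2)
      \<le> \<rho>\<^sup>2 * card A * card B * (\<Sum>\<^sub>\<infinity>x\<in>carrier G. (f x)\<^sup>2)"
    by (simp add: \<zeta>_def nA_def nB_def)
qed

lemma edge_weight_nonneg:
  assumes "edge_weight G A B \<rho> R"
  shows "0 \<le> \<rho>"
proof -
  have "0 \<le> orbit_sum G B R \<one>"
    by (rule B.orbit_sum_nonneg) (use assms in \<open>auto simp: edge_weight_def less_imp_le\<close>)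
  then show ?thesis
    using assms A.in_carrier[OF A.one_mem] unfolding edge_weight_def by (meson order_trans)
qed

abbreviation "conv \<equiv> left_regular_lin G (set_elt A \<otimes>\<^bsub>group_ring G\<^esub> set_elt B)"

lemma ell2_norm_conv_le:
  assumes R: "edge_weight G A B \<rho> R" and \<xi>: "\<xi> \<in> ell2 G"
  shows "ell2_norm G (conv \<xi>) \<le> sqrt (card A * card B) * \<rho> * ell2_norm G \<xi>"
proof -
  define f where "f x = cmod (\<xi> x)" for x
  have f: "(\<lambda>x. (f x)\<^sup>2) summable_on carrier G"
    using \<xi> by (simp add: ell2_def f_def)
  note S = orbit_sum_square_summable[OF R f]
  have le: "(cmod (conv \<xi> x))\<^sup>2 \<le> (orbit_sum G A (orbit_sum G B f) x)\<^sup>2" if "x \<in> carrier G" for x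
  proof -
    have "cmod (conv \<xi> x) \<le> orbit_sum G A (orbit_sum G B f) x"
      using that unfolding left_regular_lin_set_elt_mult
      by (auto simp: orbit_sum_def f_def intro!: sum_norm_le)
    then show ?thesis
      by (rule power_mono) simp
  qed
  have "(\<Sum>\<^sub>\<infinity>x\<in>carrier G. (cmod (conv \<xi> x))\<^sup>2)
      \<le> (\<Sum>\<^sub>\<infinity>x\<in>carrier G. (orbit_sum G A (orbit_sum G B f) x)\<^sup>2)"
    by (rule infsum_mono[OF summable_on_comparison_test[OF S(1)] S(1)]) (use le in auto)
  also note S(2)
  finally have "ell2_norm G (conv \<xi>)
      \<le> sqrt (\<rho>\<^sup>2 * card A * card B * (\<Sum>\<^sub>\<infinity>x\<in>carrier G. (cmod (\<xi> x))\<^sup>2))"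
    by (simp add: ell2_norm_def f_def)
  also have "\<dots> = sqrt (card A * card B) * \<rho> * ell2_norm G \<xi>"
    using edge_weight_nonneg[OF R] by (simp add: ell2_norm_def real_sqrt_mult)
  finally show ?thesis .
qed

lemma ell2_zero: "(\<lambda>x. 0) \<in> ell2 G"
  by (simp add: ell2_def)

theorem prod_norm_le:
  assumes R: "edge_weight G A B \<rho> R"
  shows "prod_norm \<le> sqrt (card A * card B) * \<rho>"
  unfolding prod_norm_def group_ring_norm_def ell2_opnorm_def
proof (rule cSUP_least)
  show "{\<xi> \<in> ell2 G. ell2_norm G \<xi> \<le> 1} \<noteq> {}"
    using ell2_zero by (auto simp: ell2_norm_def)
next
  fix \<xi> assume \<xi>: "\<xi> \<in> {\<xi> \<in> ell2 G. ell2_norm G \<xi> \<le> 1}"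
  then have "ell2_norm G (conv \<xi>) \<le> sqrt (card A * card B) * \<rho> * ell2_norm G \<xi>"
    using ell2_norm_conv_le[OF R] by simp
  also have "\<dots> \<le> sqrt (card A * card B) * \<rho> * 1"
    using \<xi> edge_weight_nonneg[OF R] by (intro mult_left_mono) auto
  finally show "ell2_norm G (conv \<xi>) \<le> sqrt (card A * card B) * \<rho>"
    by simp
qed

end

section \<open>Superharmonic pairs from a small norm\<close>

definition l2 :: "'a set \<Rightarrow> ('a \<Rightarrow> real) \<Rightarrow> real" where
  "l2 X f = sqrt (\<Sum>\<^sub>\<infinity>x\<in>X. (f x)\<^sup>2)"

lemma infsum_finite_support:
  fixes f :: "'a \<Rightarrow> real"
  assumes "finite S" "S \<subseteq> X" "\<And>x. x \<in> X - S \<Longrightarrow> f x = 0"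
  shows "infsum f X = sum f S"
  by (rule infsumI, rule has_sum_finite_neutralI[OF assms(1,2)]) (use assms(3) in auto)

lemma l2_nonneg: "0 \<le> l2 X f"
  by (simp add: l2_def infsum_nonneg)

lemma l2_power2: "(l2 X f)\<^sup>2 = (\<Sum>\<^sub>\<infinity>x\<in>X. (f x)\<^sup>2)"
  by (simp add: l2_def infsum_nonneg)

lemma l2_scale: "0 \<le> c \<Longrightarrow> l2 X (\<lambda>x. c * f x) = c * l2 X f"
  by (simp add: l2_def power_mult_distrib infsum_cmult_right' real_sqrt_mult)

lemma l2_cong: "(\<And>x. x \<in> X \<Longrightarrow> f x = g x) \<Longrightarrow> l2 X f = l2 X g"
  unfolding l2_def by (intro arg_cong[where f = sqrt] infsum_cong) auto

lemma l2_Cauchy_Schwarz: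
  assumes "finite {x \<in> X. f x \<noteq> 0}" "finite {x \<in> X. g x \<noteq> 0}"
  shows "(\<Sum>\<^sub>\<infinity>x\<in>X. f x * g x) \<le> l2 X f * l2 X g"
proof -
  define S where "S = {x \<in> X. f x \<noteq> 0} \<union> {x \<in> X. g x \<noteq> 0}"
  have S: "finite S" "S \<subseteq> X"
    using assms by (auto simp: S_def)
  have *: "(\<Sum>\<^sub>\<infinity>x\<in>X. f x * g x) = (\<Sum>x\<in>S. f x * g x)"
    "(\<Sum>\<^sub>\<infinity>x\<in>X. (f x)\<^sup>2) = (\<Sum>x\<in>S. (f x)\<^sup>2)"
    "(\<Sum>\<^sub>\<infinity>x\<in>X. (g x)\<^sup>2) = (\<Sum>x\<in>S. (g x)\<^sup>2)"
    by (rule infsum_finite_support[OF S]; force simp: S_def)+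
  have "(\<Sum>x\<in>S. f x * g x) \<le> sqrt ((\<Sum>x\<in>S. f x * g x)\<^sup>2)"
    by simp
  also have "\<dots> \<le> sqrt ((\<Sum>x\<in>S. (f x)\<^sup>2) * (\<Sum>x\<in>S. (g x)\<^sup>2))"
    by (rule real_sqrt_le_mono[OF Cauchy_Schwarz_ineq_sum])
  finally show ?thesis
    by (simp add: l2_def * real_sqrt_mult)
qed

lemma abs_le_l2:
  assumes "finite {x \<in> X. f x \<noteq> 0}" "x \<in> X"
  shows "\<bar>f x\<bar> \<le> l2 X f"
proof -
  define S where "S = insert x {x \<in> X. f x \<noteq> 0}"
  have "(\<Sum>\<^sub>\<infinity>x\<in>X. (f x)\<^sup>2) = (\<Sum>x\<in>S. (f x)\<^sup>2)"
    by (rule infsum_finite_support) (use assms in \<open>auto simp: S_def\<close>)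
  moreover have "(f x)\<^sup>2 \<le> (\<Sum>x\<in>S. (f x)\<^sup>2)"
    by (rule member_le_sum) (use assms in \<open>auto simp: S_def\<close>)
  ultimately show ?thesis
    using real_sqrt_le_mono by (fastforce simp: l2_def)
qed

text \<open>Functions \<open>\<phi>\<close> on the cosets of \<open>A\<close> and \<open>\<psi>\<close> on the
  cosets of \<open>B\<close>, written as invariant functions on the group.\<close>

definition superharmonic_pair ::
  "('a, 'b) monoid_scheme \<Rightarrow> 'a set \<Rightarrow> 'a set \<Rightarrow> real \<Rightarrow> ('a \<Rightarrow> real) \<Rightarrow> ('a \<Rightarrow> real) \<Rightarrow> bool" where
  "superharmonic_pair G A B \<rho> \<phi> \<psi> \<longleftrightarrow>
     (\<forall>x\<in>carrier G. 0 < \<phi> x \<and> 0 < \<psi> x \<and>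
        (\<forall>a\<in>A. \<phi> (a \<otimes>\<^bsub>G\<^esub> x) = \<phi> x) \<and> (\<forall>b\<in>B. \<psi> (b \<otimes>\<^bsub>G\<^esub> x) = \<psi> x) \<and>
        orbit_sum G A \<psi> x \<le> \<rho> * \<phi> x \<and> orbit_sum G B \<phi> x \<le> \<rho> * \<psi> x)"

context finite_subgroup_pair
begin

lemma superharmonic_pair_edge_weight:
  assumes "superharmonic_pair G A B \<rho> \<phi> \<psi>"
  shows "edge_weight G A B \<rho> (\<lambda>x. \<phi> x / \<psi> x)"
  unfolding edge_weight_def
proof (intro ballI conjI)
  fix x assume x: "x \<in> carrier G"
  note * = assms[unfolded superharmonic_pair_def, rule_format, OF x]
  show "0 < \<phi> x / \<psi> x"
    using * by simp
  have "orbit_sum G A (\<lambda>y. 1 / (\<phi> y / \<psi> y)) x = orbit_sum G A \<psi> x / \<phi> x"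
    using * by (simp add: orbit_sum_def sum_divide_distrib)
  then show "orbit_sum G A (\<lambda>y. 1 / (\<phi> y / \<psi> y)) x \<le> \<rho>"
    using * by (simp add: divide_le_eq)
  have "orbit_sum G B (\<lambda>y. \<phi> y / \<psi> y) x = orbit_sum G B \<phi> x / \<psi> x"
    using * by (simp add: orbit_sum_def sum_divide_distrib)
  then show "orbit_sum G B (\<lambda>y. \<phi> y / \<psi> y) x \<le> \<rho>"
    using * by (simp add: divide_le_eq)
qed

lemma trivial_edge_weight: "edge_weight G A B (real (max (card A) (card B))) (\<lambda>_. 1)"
  by (simp add: edge_weight_def orbit_sum_def)

lemma bdd_above_conv: "bdd_above ((\<lambda>\<xi>. ell2_norm G (conv \<xi>)) ` {\<xi> \<in> ell2 G. ell2_norm G \<xi> \<le> 1})"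
proof (rule bdd_aboveI2)
  fix \<xi> assume \<xi>: "\<xi> \<in> {\<xi> \<in> ell2 G. ell2_norm G \<xi> \<le> 1}"
  define K where "K = sqrt (card A * card B) * real (max (card A) (card B))"
  have "ell2_norm G (conv \<xi>) \<le> K * ell2_norm G \<xi>"
    unfolding K_def using ell2_norm_conv_le[OF trivial_edge_weight, of \<xi>] \<xi> by simp
  also have "\<dots> \<le> K * 1"
    by (rule mult_left_mono) (use \<xi> in \<open>auto simp: K_def\<close>)
  finally show "ell2_norm G (conv \<xi>) \<le> K"
    by simp
qed

lemma conv_scale: "conv (\<lambda>x. c * \<xi> x) = (\<lambda>x. c * conv \<xi> x)"
  by (auto simp: left_regular_lin_set_elt_mult orbit_sum_def sum_distrib_left)

lemma ell2_norm_scale: "ell2_norm G (\<lambda>x. c * \<xi> x) = cmod c * ell2_norm G \<xi>"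
  by (simp add: ell2_norm_def norm_mult power_mult_distrib infsum_cmult_right' real_sqrt_mult)

lemma ell2_norm_nonneg: "0 \<le> ell2_norm G \<xi>"
  by (simp add: ell2_norm_def infsum_nonneg)

lemma ell2_norm_conv_le_prod_norm:
  assumes \<xi>: "\<xi> \<in> ell2 G"
  shows "ell2_norm G (conv \<xi>) \<le> prod_norm * ell2_norm G \<xi>"
proof (cases "ell2_norm G \<xi> = 0")
  case True
  then show ?thesis
    using ell2_norm_conv_le[OF trivial_edge_weight \<xi>] by simp
next
  case False
  define t where "t = ell2_norm G \<xi>"
  have t: "0 < t"
    using False ell2_norm_nonneg[of \<xi>] by (simp add: t_def)
  define \<eta> where "\<eta> x = complex_of_real (1 / t) * \<xi> x" for x
  have "(\<lambda>x. (1 / t)\<^sup>2 * (cmod (\<xi> x))\<^sup>2) summable_on carrier G"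
    using \<xi> by (intro summable_on_cmult_right) (simp add: ell2_def)
  then have "\<eta> \<in> ell2 G"
    using \<xi> by (simp add: ell2_def \<eta>_def norm_divide norm_mult power_divide power_mult_distrib)
  moreover have "ell2_norm G \<eta> = 1"
    unfolding \<eta>_def ell2_norm_scale using t by (simp add: t_def norm_divide)
  ultimately have "ell2_norm G (conv \<eta>) \<le> prod_norm"
    unfolding prod_norm_def group_ring_norm_def ell2_opnorm_def
    by (intro cSUP_upper[OF _ bdd_above_conv]) auto
  moreover have "ell2_norm G (conv \<eta>) = ell2_norm G (conv \<xi>) / t"
    unfolding \<eta>_def conv_scale ell2_norm_scale using t by (simp add: norm_divide)
  ultimately show ?thesis
    using t by (simp add: divide_le_eq t_def)
qed

lemma prod_norm_nonneg: "0 \<le> prod_norm"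
proof -
  have "0 \<le> ell2_norm G (conv (\<lambda>x. 0))"
    by (rule ell2_norm_nonneg)
  also have "\<dots> \<le> prod_norm"
    unfolding prod_norm_def group_ring_norm_def ell2_opnorm_def
    by (intro cSUP_upper[OF _ bdd_above_conv]) (auto simp: ell2_zero ell2_norm_def)
  finally show ?thesis .
qed

lemma l2_conv_le:
  assumes f: "finite {x \<in> carrier G. f x \<noteq> 0}"
  shows "l2 (carrier G) (orbit_sum G A (orbit_sum G B f)) \<le> prod_norm * l2 (carrier G) f"
proof -
  define \<xi> where "\<xi> x = (if x \<in> carrier G then complex_of_real (f x) else 0)" for x
  have "(\<lambda>x. (cmod (\<xi> x))\<^sup>2) summable_on carrier G"
    by (rule finite_nonzero_values_imp_summable_on, rule finite_subset[OF _ f])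
       (auto simp: \<xi>_def)
  then have \<xi>: "\<xi> \<in> ell2 G"
    by (simp add: ell2_def \<xi>_def)
  have "ell2_norm G \<xi> = l2 (carrier G) f"
    unfolding ell2_norm_def l2_def
    by (intro arg_cong[where f = sqrt] infsum_cong) (auto simp: \<xi>_def)
  moreover have "ell2_norm G (conv \<xi>) = l2 (carrier G) (orbit_sum G A (orbit_sum G B f))"
    unfolding ell2_norm_def l2_def
  proof (intro arg_cong[where f = sqrt] infsum_cong)
    fix x assume x: "x \<in> carrier G"
    have "conv \<xi> x = complex_of_real (orbit_sum G A (orbit_sum G B f) x)"
      using x by (simp add: left_regular_lin_set_elt_mult orbit_sum_def \<xi>_def A.in_carrier B.in_carrier)
    then show "(cmod (conv \<xi> x))\<^sup>2 = (orbit_sum G A (orbit_sum G B f) x)\<^sup>2"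
      by simp
  qed
  ultimately show ?thesis
    using ell2_norm_conv_le_prod_norm[OF \<xi>] by simp
qed

lemma l2_orbit_sum_A_le:
  assumes f: "finite {x \<in> carrier G. f x \<noteq> 0}"
    and inv: "\<And>x b. x \<in> carrier G \<Longrightarrow> b \<in> B \<Longrightarrow> f (b \<otimes> x) = f x"
  shows "card B * l2 (carrier G) (orbit_sum G A f) \<le> prod_norm * l2 (carrier G) f"
proof -
  have "orbit_sum G A (orbit_sum G B f) x = card B * orbit_sum G A f x" if "x \<in> carrier G" for x
    unfolding orbit_sum_def[of G A] sum_distrib_left
    by (rule sum.cong) (use that inv A.in_carrier in \<open>auto intro!: B.orbit_sum_invariant\<close>)
  then have "l2 (carrier G) (orbit_sum G A (orbit_sum G B f))
      = l2 (carrier G) (\<lambda>x. card B * orbit_sum G A f x)"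
    by (rule l2_cong)
  then show ?thesis
    using l2_conv_le[OF f] by (simp add: l2_scale)
qed

text \<open>The adjoint of the product of coset sums has the same norm. Concretely, let \<open>k\<close> be the
  sum of \<open>f\<close> over cosets of \<open>B\<close>; then the square norm of \<open>k\<close> is
  \<open>card B / card A\<close> times the inner product of \<open>f\<close> with the sum of \<open>k\<close>
  over cosets of \<open>A\<close>, and the latter is estimated by \<open>l2_orbit_sum_A_le\<close> because
  \<open>k\<close> is \<open>B\<close>-invariant.\<close>

lemma l2_orbit_sum_B_le:
  assumes f: "finite {x \<in> carrier G. f x \<noteq> 0}"
    and inv: "\<And>x a. x \<in> carrier G \<Longrightarrow> a \<in> A \<Longrightarrow> f (a \<otimes> x) = f x"
  shows "card A * l2 (carrier G) (orbit_sum G B f) \<le> prod_norm * l2 (carrier G) f"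
proof -
  let ?X = "carrier G"
  define k where "k = orbit_sum G B f"
  have k: "finite {x \<in> ?X. k x \<noteq> 0}"
    unfolding k_def by (rule B.finite_support_orbit_sum[OF f])
  have k_inv: "k (b \<otimes> x) = k x" if "x \<in> ?X" "b \<in> B" for x b
    using that by (simp add: k_def B.orbit_sum_translate)
  have "card A * (l2 ?X k)\<^sup>2 = card A * (\<Sum>\<^sub>\<infinity>x\<in>?X. orbit_sum G B f x * k x)"
    by (simp only: l2_power2) (simp only: power2_eq_square k_def)
  also have "\<dots> = card A * (\<Sum>\<^sub>\<infinity>x\<in>?X. f x * orbit_sum G B k x)"
    by (simp add: B.orbit_sum_self_adjoint[OF f])
  also have "(\<Sum>\<^sub>\<infinity>x\<in>?X. f x * orbit_sum G B k x) = (\<Sum>\<^sub>\<infinity>x\<in>?X. card B * (f x * k x))"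
    by (rule infsum_cong) (simp add: B.orbit_sum_invariant k_inv)
  also have "card A * \<dots> = card B * (\<Sum>\<^sub>\<infinity>x\<in>?X. card A * f x * k x)"
    by (simp add: infsum_cmult_right' mult.assoc)
  also have "(\<Sum>\<^sub>\<infinity>x\<in>?X. card A * f x * k x) = (\<Sum>\<^sub>\<infinity>x\<in>?X. orbit_sum G A f x * k x)"
    by (rule infsum_cong) (simp add: A.orbit_sum_invariant inv)
  also have "\<dots> = (\<Sum>\<^sub>\<infinity>x\<in>?X. f x * orbit_sum G A k x)"
    by (simp add: A.orbit_sum_self_adjoint[OF f])
  also have "card B * \<dots> \<le> card B * (l2 ?X f * l2 ?X (orbit_sum G A k))"
    by (intro mult_left_mono l2_Cauchy_Schwarz f A.finite_support_orbit_sum k) auto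
  also have "\<dots> = l2 ?X f * (card B * l2 ?X (orbit_sum G A k))"
    by simp
  also have "\<dots> \<le> l2 ?X f * (prod_norm * l2 ?X k)"
    by (intro mult_left_mono l2_orbit_sum_A_le k k_inv l2_nonneg)
  finally have "card A * l2 ?X k * l2 ?X k \<le> prod_norm * l2 ?X f * l2 ?X k"
    by (simp add: power2_eq_square mult_ac)
  then have "card A * l2 ?X k \<le> prod_norm * l2 ?X f"
  proof (cases "l2 ?X k = 0")
    case True
    then show ?thesis
      using prod_norm_nonneg l2_nonneg[of ?X f] by simp
  next
    case False
    then have "0 < l2 ?X k"
      using l2_nonneg[of ?X k] by simp
    then show ?thesis
      using \<open>card A * l2 ?X k * l2 ?X k \<le> prod_norm * l2 ?X f * l2 ?X k\<close>
      by (metis mult_le_cancel_right_pos)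
  qed
  then show ?thesis
    by (simp add: k_def)
qed

text \<open>\<open>walks n x\<close> is the number of ways to write \<open>x\<close> as a product of the form
  \<open>b\<^sub>n a\<^sub>n \<dots> b\<^sub>1 a\<^sub>1 b\<^sub>0\<close> with factors in \<open>A\<close> and
  \<open>B\<close>.\<close>

primrec walks :: "nat \<Rightarrow> 'a \<Rightarrow> real" where
  "walks 0 = orbit_sum G B (\<lambda>x. if x = \<one> then 1 else 0)"
| "walks (Suc n) = orbit_sum G B (orbit_sum G A (walks n))"

lemma walks_nonneg: "x \<in> carrier G \<Longrightarrow> 0 \<le> walks n x"
  by (induction n arbitrary: x)
     (auto intro!: A.orbit_sum_nonneg B.orbit_sum_nonneg)

lemma walks_finite_support: "finite {x \<in> carrier G. walks n x \<noteq> 0}"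
  by (induction n)
     (auto intro!: A.finite_support_orbit_sum B.finite_support_orbit_sum)

lemma walks_invariant: "x \<in> carrier G \<Longrightarrow> b \<in> B \<Longrightarrow> walks n (b \<otimes> x) = walks n x"
  by (cases n) (auto simp: B.orbit_sum_translate)

lemma l2_walks_le:
  "l2 (carrier G) (walks n) \<le> (prod_norm\<^sup>2 / (card A * card B)) ^ n * l2 (carrier G) (walks 0)"
proof (induction n)
  case (Suc n)
  let ?X = "carrier G"
  have cA: "0 < real (card A)" and cB: "0 < real (card B)"
    using A.card_pos B.card_pos by auto
  have "card A * card B * l2 ?X (walks (Suc n))
      = card B * (card A * l2 ?X (orbit_sum G B (orbit_sum G A (walks n))))"
    by simp
  also have "\<dots> \<le> card B * (prod_norm * l2 ?X (orbit_sum G A (walks n)))"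
    by (intro mult_left_mono l2_orbit_sum_B_le A.finite_support_orbit_sum walks_finite_support)
       (auto simp: A.orbit_sum_translate)
  also have "\<dots> = prod_norm * (card B * l2 ?X (orbit_sum G A (walks n)))"
    by simp
  also have "\<dots> \<le> prod_norm * (prod_norm * l2 ?X (walks n))"
    by (intro mult_left_mono l2_orbit_sum_A_le walks_finite_support prod_norm_nonneg)
       (auto simp: walks_invariant)
  finally have "l2 ?X (walks (Suc n)) \<le> prod_norm\<^sup>2 / (card A * card B) * l2 ?X (walks n)"
    using cA cB by (simp add: field_simps power2_eq_square)
  also have "\<dots> \<le> prod_norm\<^sup>2 / (card A * card B) *
      ((prod_norm\<^sup>2 / (card A * card B)) ^ n * l2 ?X (walks 0))"
    by (intro mult_left_mono Suc.IH) simp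
  finally show ?case
    by (simp add: mult.assoc)
qed simp

text \<open>The function \<open>\<psi> = (\<Sum>n. walks n / \<rho> ^ (2 * n))\<close> converges because the
  norms of \<open>walks n\<close> grow at most like the powers of
  \<open>prod_norm\<^sup>2 / (card A * card B) < \<rho>\<^sup>2\<close>. Applying the two coset sums shifts the
  series by one term, so \<open>\<psi>\<close> is an eigenfunction for \<open>\<rho>\<^sup>2\<close> up to the
  missing nonnegative term \<open>walks 0\<close>.\<close>

lemma superharmonic_pair_near_one:
  assumes N: "prod_norm < sqrt (card A * card B) * \<rho>"
  obtains \<psi> \<phi> where
    "\<psi> \<one> > 0"
    "\<And>x. x \<in> carrier G \<Longrightarrow> 0 \<le> \<psi> x"
    "\<And>x. x \<in> carrier G \<Longrightarrow> 0 \<le> \<phi> x"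
    "\<And>x a. x \<in> carrier G \<Longrightarrow> a \<in> A \<Longrightarrow> \<phi> (a \<otimes> x) = \<phi> x"
    "\<And>x b. x \<in> carrier G \<Longrightarrow> b \<in> B \<Longrightarrow> \<psi> (b \<otimes> x) = \<psi> x"
    "\<And>x. x \<in> carrier G \<Longrightarrow> orbit_sum G A \<psi> x \<le> \<rho> * \<phi> x"
    "\<And>x. x \<in> carrier G \<Longrightarrow> orbit_sum G B \<phi> x \<le> \<rho> * \<psi> x"
proof -
  have cA: "0 < real (card A)" and cB: "0 < real (card B)"
    using A.card_pos B.card_pos by auto
  have "0 < sqrt (card A * card B) * \<rho>"
    using N prod_norm_nonneg by linarith
  then have \<rho>: "0 < \<rho>"
    by (rule zero_less_mult_pos) (use cA cB in simp)
  define q where "q = prod_norm\<^sup>2 / (card A * card B) / \<rho>\<^sup>2"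
  have "prod_norm\<^sup>2 < (sqrt (card A * card B) * \<rho>)\<^sup>2"
    by (rule power_strict_mono[OF N prod_norm_nonneg]) simp
  then have "q < 1"
    using cA cB \<rho> by (simp add: q_def power_mult_distrib field_simps)
  moreover have "0 \<le> q"
    by (simp add: q_def)
  ultimately have geom: "summable (\<lambda>n. q ^ n * l2 (carrier G) (walks 0))"
    by (intro summable_mult2 summable_geometric) simp
  define w where "w n x = walks n x / (\<rho>\<^sup>2) ^ n" for n x
  define \<psi> where "\<psi> x = (\<Sum>n. w n x)" for x
  define \<phi> where "\<phi> x = orbit_sum G A \<psi> x / \<rho>" for x
  have w_nonneg: "0 \<le> w n x" if "x \<in> carrier G" for n x
    using walks_nonneg[OF that] by (simp add: w_def)
  have "summable (\<lambda>n. w n x)" if x: "x \<in> carrier G" for x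
  proof (rule summable_comparison_test'[OF geom])
    fix n :: nat
    have "\<bar>walks n x\<bar> \<le> (prod_norm\<^sup>2 / (card A * card B)) ^ n * l2 (carrier G) (walks 0)"
      by (rule order_trans[OF abs_le_l2[OF walks_finite_support x] l2_walks_le])
    then have "\<bar>walks n x\<bar> / (\<rho>\<^sup>2) ^ n
        \<le> (prod_norm\<^sup>2 / (card A * card B)) ^ n * l2 (carrier G) (walks 0) / (\<rho>\<^sup>2) ^ n"
      by (rule divide_right_mono) simp
    then show "norm (w n x) \<le> q ^ n * l2 (carrier G) (walks 0)"
      by (simp only: w_def q_def power_divide[of _ "\<rho>\<^sup>2"] real_norm_def abs_divide) simp
  qed
  then have sums: "(\<lambda>n. w n x) sums \<psi> x" if "x \<in> carrier G" for x
    unfolding \<psi>_def using that by (simp add: summable_sums)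
  have sumsA: "(\<lambda>n. orbit_sum G A (w n) x) sums orbit_sum G A \<psi> x" if "x \<in> carrier G" for x
    unfolding orbit_sum_def by (rule sums_sum) (use that A.in_carrier sums in auto)
  have sumsBA: "(\<lambda>n. orbit_sum G B (orbit_sum G A (w n)) x) sums orbit_sum G B (orbit_sum G A \<psi>) x"
    if "x \<in> carrier G" for x
    unfolding orbit_sum_def[of G B] by (rule sums_sum) (use that B.in_carrier sumsA in auto)
  have w_Suc: "orbit_sum G B (orbit_sum G A (w n)) x = \<rho>\<^sup>2 * w (Suc n) x" for n x
    using \<rho> by (simp add: w_def orbit_sum_def sum_divide_distrib[symmetric])
  have step: "orbit_sum G B (orbit_sum G A \<psi>) x \<le> \<rho>\<^sup>2 * \<psi> x" if x: "x \<in> carrier G" for x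
  proof -
    have "(\<lambda>n. w (Suc n) x) sums (\<psi> x - w 0 x)"
      using sums[OF x] by (simp add: sums_Suc_iff[of "\<lambda>n. w n x"])
    then have "(\<lambda>n. \<rho>\<^sup>2 * w (Suc n) x) sums (\<rho>\<^sup>2 * (\<psi> x - w 0 x))"
      by (rule sums_mult)
    then have "orbit_sum G B (orbit_sum G A \<psi>) x = \<rho>\<^sup>2 * (\<psi> x - w 0 x)"
      using sumsBA[OF x] unfolding w_Suc by (rule sums_unique2[symmetric])
    then show ?thesis
      using w_nonneg[OF x, of 0] by (simp add: right_diff_distrib)
  qed
  have \<psi>_nonneg: "0 \<le> \<psi> x" if "x \<in> carrier G" for x
    by (rule sums_le[OF _ sums_zero sums[OF that]]) (use w_nonneg that in auto)
  have \<psi>_ge: "w 0 x \<le> \<psi> x" if x: "x \<in> carrier G" for x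
    unfolding \<psi>_def
    using sum_le_suminf[OF sums_summable[OF sums[OF x]], of "{0}"] w_nonneg[OF x] by simp
  show thesis
  proof (rule that[of \<psi> \<phi>])
    have "1 \<le> w 0 \<one>"
      using B.orbit_sum_ge_self[of "\<lambda>x. if x = \<one> then 1 else 0" \<one>] by (simp add: w_def)
    then show "0 < \<psi> \<one>"
      using \<psi>_ge[of \<one>] by simp
  next
    fix x assume x: "x \<in> carrier G"
    show "0 \<le> \<psi> x"
      by (rule \<psi>_nonneg[OF x])
    show "0 \<le> \<phi> x"
      unfolding \<phi>_def using A.orbit_sum_nonneg[OF \<psi>_nonneg x] \<rho> by simp
    show "orbit_sum G A \<psi> x \<le> \<rho> * \<phi> x"
      using \<rho> by (simp add: \<phi>_def)
    have "orbit_sum G B \<phi> x = orbit_sum G B (orbit_sum G A \<psi>) x / \<rho>"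
      by (simp add: \<phi>_def orbit_sum_def[of G B] sum_divide_distrib)
    then show "orbit_sum G B \<phi> x \<le> \<rho> * \<psi> x"
      using step[OF x] \<rho> by (simp add: divide_le_eq power2_eq_square mult_ac)
  next
    fix x a assume "x \<in> carrier G" "a \<in> A"
    then show "\<phi> (a \<otimes> x) = \<phi> x"
      by (simp add: \<phi>_def A.orbit_sum_translate)
  next
    fix x b assume "x \<in> carrier G" "b \<in> B"
    then show "\<psi> (b \<otimes> x) = \<psi> x"
      by (simp add: \<psi>_def w_def walks_invariant)
  qed
qed

text \<open>The pair from \<open>superharmonic_pair_near_one\<close> vanishes outside of the subgroup generated
  by \<open>A\<close> and \<open>B\<close>. The other right cosets of this subgroup receive translated copies:
  \<open>\<sigma> x\<close> chooses a base point of the coset of \<open>x\<close>.\<close>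

theorem superharmonic_pair_exists:
  assumes N: "prod_norm < sqrt (card A * card B) * \<rho>"
  obtains \<phi> \<psi> where "superharmonic_pair G A B \<rho> \<phi> \<psi>"
proof -
  obtain \<psi>0 \<phi>0 where one: "\<psi>0 \<one> > 0"
    and \<psi>0: "\<And>x. x \<in> carrier G \<Longrightarrow> 0 \<le> \<psi>0 x"
    and \<phi>0: "\<And>x. x \<in> carrier G \<Longrightarrow> 0 \<le> \<phi>0 x"
    and \<phi>0_inv: "\<And>x a. x \<in> carrier G \<Longrightarrow> a \<in> A \<Longrightarrow> \<phi>0 (a \<otimes> x) = \<phi>0 x"
    and \<psi>0_inv: "\<And>x b. x \<in> carrier G \<Longrightarrow> b \<in> B \<Longrightarrow> \<psi>0 (b \<otimes> x) = \<psi>0 x"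
    and A_le: "\<And>x. x \<in> carrier G \<Longrightarrow> orbit_sum G A \<psi>0 x \<le> \<rho> * \<phi>0 x"
    and B_le: "\<And>x. x \<in> carrier G \<Longrightarrow> orbit_sum G B \<phi>0 x \<le> \<rho> * \<psi>0 x"
    by (fact superharmonic_pair_near_one[OF N])
  have \<psi>0_le: "\<psi>0 x \<le> \<rho> * \<phi>0 x" if "x \<in> carrier G" for x
    using A.orbit_sum_ge_self[where f = \<psi>0, OF \<psi>0 that] A_le[OF that] by linarith
  have \<phi>0_le: "\<phi>0 x \<le> \<rho> * \<psi>0 x" if "x \<in> carrier G" for x
    using B.orbit_sum_ge_self[where f = \<phi>0, OF \<phi>0 that] B_le[OF that] by linarith
  have supp: "0 < \<phi>0 x \<longleftrightarrow> 0 < \<psi>0 x" if x: "x \<in> carrier G" for x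
  proof -
    have "\<psi>0 x = 0" if "\<phi>0 x = 0"
      using \<psi>0_le[OF x] \<psi>0[OF x] that by simp
    moreover have "\<phi>0 x = 0" if "\<psi>0 x = 0"
      using \<phi>0_le[OF x] \<phi>0[OF x] that by simp
    ultimately show ?thesis
      using \<psi>0[OF x] \<phi>0[OF x] by fastforce
  qed
  have supp_A: "0 < \<psi>0 (a \<otimes> x) \<longleftrightarrow> 0 < \<psi>0 x" if "x \<in> carrier G" "a \<in> A" for a x
    using supp[of x] supp[of "a \<otimes> x"] \<phi>0_inv[of x a] that A.in_carrier by simp
  \<comment> \<open>The set of eligible \<open>y\<close> is unchanged when \<open>x\<close> is multiplied from the left by elements of \<open>A\<close> and
    \<open>B\<close>, because the support of \<open>\<psi>0\<close> is.\<close>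
  define \<sigma> where "\<sigma> x = (SOME y. y \<in> carrier G \<and> 0 < \<psi>0 (x \<otimes> inv y))" for x
  have \<sigma>: "\<sigma> x \<in> carrier G \<and> 0 < \<psi>0 (x \<otimes> inv (\<sigma> x))" if "x \<in> carrier G" for x
    unfolding \<sigma>_def by (rule someI[of _ x]) (use that one in auto)
  have \<sigma>A: "\<sigma> (a \<otimes> x) = \<sigma> x" if "x \<in> carrier G" "a \<in> A" for a x
  proof -
    have "0 < \<psi>0 (a \<otimes> x \<otimes> inv y) \<longleftrightarrow> 0 < \<psi>0 (x \<otimes> inv y)" if "y \<in> carrier G" for y
      using supp_A[of "x \<otimes> inv y" a] that \<open>x \<in> carrier G\<close> \<open>a \<in> A\<close>
      by (simp add: A.m_assoc A.in_carrier)
    then show ?thesis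
      unfolding \<sigma>_def by (intro arg_cong[where f = Eps]) blast
  qed
  have \<sigma>B: "\<sigma> (b \<otimes> x) = \<sigma> x" if "x \<in> carrier G" "b \<in> B" for b x
  proof -
    have "\<psi>0 (b \<otimes> x \<otimes> inv y) = \<psi>0 (x \<otimes> inv y)" if "y \<in> carrier G" for y
      using \<psi>0_inv[of "x \<otimes> inv y" b] that \<open>x \<in> carrier G\<close> \<open>b \<in> B\<close>
      by (simp add: A.m_assoc B.in_carrier)
    then show ?thesis
      unfolding \<sigma>_def by (intro arg_cong[where f = Eps]) (auto simp: fun_eq_iff)
  qed
  define \<phi> \<psi> where "\<phi> x = \<phi>0 (x \<otimes> inv (\<sigma> x))" and "\<psi> x = \<psi>0 (x \<otimes> inv (\<sigma> x))" for x
  have "superharmonic_pair G A B \<rho> \<phi> \<psi>"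
    unfolding superharmonic_pair_def
  proof (intro ballI conjI)
    fix x assume x: "x \<in> carrier G"
    define y where "y = x \<otimes> inv (\<sigma> x)"
    have y: "y \<in> carrier G" "0 < \<psi>0 y"
      using \<sigma>[OF x] x by (auto simp: y_def)
    show "0 < \<psi> x" "0 < \<phi> x"
      using y supp by (auto simp: \<phi>_def \<psi>_def y_def)
    have A: "(a \<otimes> x) \<otimes> inv (\<sigma> (a \<otimes> x)) = a \<otimes> y" if "a \<in> A" for a
      using that x \<sigma>[OF x] by (simp add: \<sigma>A y_def A.m_assoc A.in_carrier)
    have B: "(b \<otimes> x) \<otimes> inv (\<sigma> (b \<otimes> x)) = b \<otimes> y" if "b \<in> B" for b
      using that x \<sigma>[OF x] by (simp add: \<sigma>B y_def A.m_assoc B.in_carrier)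
    show "\<phi> (a \<otimes> x) = \<phi> x" if "a \<in> A" for a
      unfolding \<phi>_def A[OF that] using \<phi>0_inv y that by (simp add: y_def)
    show "\<psi> (b \<otimes> x) = \<psi> x" if "b \<in> B" for b
      unfolding \<psi>_def B[OF that] using \<psi>0_inv y that by (simp add: y_def)
    have "orbit_sum G A \<psi> x = orbit_sum G A \<psi>0 y"
      unfolding orbit_sum_def \<psi>_def by (rule sum.cong) (auto simp: A)
    then show "orbit_sum G A \<psi> x \<le> \<rho> * \<phi> x"
      using A_le[OF y(1)] by (simp add: \<phi>_def y_def)
    have "orbit_sum G B \<phi> x = orbit_sum G B \<phi>0 y"
      unfolding orbit_sum_def \<phi>_def by (rule sum.cong) (auto simp: B)
    then show "orbit_sum G B \<phi> x \<le> \<rho> * \<psi> x"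
      using B_le[OF y(1)] by (simp add: \<psi>_def y_def)
  qed
  then show thesis
    by (rule that)
qed

end

section \<open>A relation pushes the norm above the free product value\<close>

text \<open>Let \<open>r\<close> be the ratio by which a positive function changes along an edge that is one of
  \<open>q\<close> ways to go on from its initial vertex. As one of \<open>q\<close> such edges it contributes
  \<open>q * r\<close> on average to the sum over the neighbours of its initial vertex, and it contributes
  \<open>1 / r\<close> to the sum over the neighbours of its end. The total is minimal, namely
  \<open>2 * sqrt q\<close>, for \<open>r = 1 / sqrt q\<close>, the critical rate of decay on a tree; the gain
  is the excess over this minimum.\<close>

definition gain :: "real \<Rightarrow> real \<Rightarrow> real" where
  "gain q r = q * r + 1 / r - 2 * sqrt q"

lemma gain_nonneg:
  assumes "0 \<le> q" "0 < r"
  shows "0 \<le> gain q r"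
proof -
  have "gain q r = (sqrt q * r - 1)\<^sup>2 / r"
    using assms by (simp add: gain_def field_simps power2_eq_square)
  then show ?thesis
    using assms by simp
qed

text \<open>An edge along which the function does not decrease has a gain bounded away from \<open>0\<close>, if
  \<open>q > 1\<close>.\<close>

lemma gain_ge:
  assumes "1 \<le> q" "1 \<le> r"
  shows "(sqrt q - 1)\<^sup>2 \<le> gain q r"
proof -
  have "0 \<le> (r - 1) * (q - 1 / r)"
    using assms by (intro mult_nonneg_nonneg) (auto simp: divide_le_eq mult_ge1_I)
  also have "\<dots> = q * r + 1 / r - q - 1"
    using assms by (simp add: field_simps)
  finally show ?thesis
    using assms by (simp add: gain_def power2_diff)
qed

abbreviation path_step :: "('a, 'b) monoid_scheme \<Rightarrow> 'a \<times> 'a \<Rightarrow> 'a \<Rightarrow> 'a" where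
  "path_step G \<equiv> \<lambda>(a, b) x. a \<otimes>\<^bsub>G\<^esub> (b \<otimes>\<^bsub>G\<^esub> x)"

context finite_subgroup_pair
begin

text \<open>Here \<open>x\<close> is the edge through which the coset \<open>B x\<close> is entered, and
  \<open>a \<otimes> (b \<otimes> x)\<close> is reached by crossing that coset and then the coset
  \<open>A (b x)\<close>. Add the condition at \<open>B x\<close> to the average of the conditions at the
  \<open>q\<close> cosets \<open>A (t x)\<close>, where \<open>t\<close> runs through
  \<open>B - {\<one>}\<close>, and express \<open>q * R + 1 / R\<close> and \<open>p / R + R\<close> by gains.
  What results says that \<open>R x\<close>, plus averages of gains, is at most \<open>2 * \<epsilon>\<close>
  plus the average of \<open>R\<close> over the \<open>p * q\<close> edges two steps further. The gains and the
  numbers \<open>M - R\<close> are nonnegative, so each single one of them is at most \<open>p * q\<close> times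
  its average.\<close>

lemma superharmonic_path_step:
  fixes p q \<epsilon> :: real
  assumes pair: "superharmonic_pair G A B \<rho> \<phi> \<psi>"
    and M: "\<And>x. x \<in> carrier G \<Longrightarrow> \<phi> x / \<psi> x \<le> M"
    and x: "x \<in> carrier G" and a: "a \<in> A - {\<one>}" and b: "b \<in> B - {\<one>}"
    and p_def: "p = card A - 1" and q_def: "q = card B - 1"
    and \<epsilon>: "\<rho> \<le> sqrt p + sqrt q + \<epsilon>"
    and R_def: "R = (\<lambda>x. \<phi> x / \<psi> x)"
  shows "gain q (R (b \<otimes> x)) + gain p (1 / R (a \<otimes> (b \<otimes> x))) + (M - R (a \<otimes> (b \<otimes> x)))
    \<le> p * q * (2 * \<epsilon> + (M - R x))"
proof -
  define A' B' where "A' = A - {\<one>}" and "B' = B - {\<one>}"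
  have fin: "finite A'" "finite B'"
    using A.finite_S B.finite_S by (auto simp: A'_def B'_def)
  have cardA: "real (card A') = p" and cardB: "real (card B') = q"
    using A.one_mem B.one_mem A.card_pos B.card_pos by (auto simp: A'_def B'_def p_def q_def card_Diff_singleton)
  have p: "0 < p" and q: "0 < q"
    using a b fin card_gt_0_iff[of A'] card_gt_0_iff[of B'] unfolding cardA[symmetric] cardB[symmetric]
    by (auto simp: A'_def B'_def)
  have R: "0 < R y" "orbit_sum G A (\<lambda>y. 1 / R y) y \<le> \<rho>" "orbit_sum G B R y \<le> \<rho>"
    if "y \<in> carrier G" for y
    using superharmonic_pair_edge_weight[OF pair] that by (auto simp: edge_weight_def R_def)
  have M: "R y \<le> M" if "y \<in> carrier G" for y
    using M[OF that] by (simp add: R_def)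
  have inA: "s \<in> carrier G" if "s \<in> A'" for s
    using that A.in_carrier by (auto simp: A'_def)
  have inB: "s \<in> carrier G" if "s \<in> B'" for s
    using that B.in_carrier by (auto simp: B'_def)
  have sumA: "orbit_sum G A f y = f y + (\<Sum>s\<in>A'. f (s \<otimes> y))" if "y \<in> carrier G" for f :: "'a \<Rightarrow> real" and y
    unfolding orbit_sum_def A'_def using that by (subst sum.remove[OF A.finite_S A.one_mem]) simp
  have sumB: "orbit_sum G B f y = f y + (\<Sum>s\<in>B'. f (s \<otimes> y))" if "y \<in> carrier G" for f :: "'a \<Rightarrow> real" and y
    unfolding orbit_sum_def B'_def using that by (subst sum.remove[OF B.finite_S B.one_mem]) simp
  define S where "S t = (\<Sum>s\<in>A'. 1 / R (s \<otimes> (t \<otimes> x)))" for t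
  have stepB: "R x + (\<Sum>t\<in>B'. R (t \<otimes> x)) \<le> \<rho>"
    using R(3)[OF x] sumB[OF x] by simp
  have stepA: "1 / R (t \<otimes> x) + S t \<le> \<rho>" if "t \<in> B'" for t
    unfolding S_def using R(2)[of "t \<otimes> x"] sumA[of "t \<otimes> x"] inB[OF that] x by simp
  have "(\<Sum>t\<in>B'. 1 / R (t \<otimes> x) + S t) \<le> (\<Sum>t\<in>B'. \<rho>)"
    by (rule sum_mono[OF stepA])
  then have avgA: "(\<Sum>t\<in>B'. 1 / R (t \<otimes> x)) + (\<Sum>t\<in>B'. S t) \<le> q * \<rho>"
    by (simp add: sum.distrib cardB)
  have pS: "p * S t = (\<Sum>s\<in>A'. gain p (1 / R (s \<otimes> (t \<otimes> x))) + 2 * sqrt p - R (s \<otimes> (t \<otimes> x)))" for t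
    by (simp add: S_def sum_distrib_left gain_def)
  have "p * q * R x + p * (\<Sum>t\<in>B'. q * R (t \<otimes> x)) \<le> p * q * \<rho>"
    using mult_left_mono[OF stepB, of "p * q"] p q
    by (simp add: distrib_left sum_distrib_left mult.assoc)
  moreover have "p * (\<Sum>t\<in>B'. 1 / R (t \<otimes> x)) + (\<Sum>t\<in>B'. p * S t) \<le> p * q * \<rho>"
    using mult_left_mono[OF avgA, of p] p by (simp add: distrib_left sum_distrib_left)
  moreover have "p * (\<Sum>t\<in>B'. q * R (t \<otimes> x)) + p * (\<Sum>t\<in>B'. 1 / R (t \<otimes> x))
      = p * (\<Sum>t\<in>B'. gain q (R (t \<otimes> x))) + p * (2 * q * sqrt q)"
    unfolding distrib_left[symmetric]
    by (simp add: gain_def sum.distrib sum_subtractf cardB)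
  moreover have "(\<Sum>t\<in>B'. p * S t) = (\<Sum>t\<in>B'. \<Sum>s\<in>A'. gain p (1 / R (s \<otimes> (t \<otimes> x))) + (M - R (s \<otimes> (t \<otimes> x))))
      + 2 * p * q * sqrt p - p * q * M"
    by (simp add: pS sum.distrib sum_subtractf cardA cardB algebra_simps)
  moreover have "p * q * (2 * \<rho>) \<le> p * q * (2 * (sqrt p + sqrt q + \<epsilon>))"
    using \<epsilon> p q by (intro mult_left_mono) auto
  ultimately have total: "p * (\<Sum>t\<in>B'. gain q (R (t \<otimes> x)))
      + (\<Sum>t\<in>B'. \<Sum>s\<in>A'. gain p (1 / R (s \<otimes> (t \<otimes> x))) + (M - R (s \<otimes> (t \<otimes> x))))
      \<le> p * q * (2 * \<epsilon> + (M - R x))"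
    by (simp add: algebra_simps)
  have "gain q (R (b \<otimes> x)) \<le> (\<Sum>t\<in>B'. gain q (R (t \<otimes> x)))"
    by (rule member_le_sum)
       (use b fin q x inB R(1) in \<open>auto simp: B'_def intro!: gain_nonneg\<close>)
  moreover have "1 \<le> p"
    using p unfolding cardA[symmetric] by simp
  moreover have g0: "0 \<le> (\<Sum>t\<in>B'. gain q (R (t \<otimes> x)))"
    by (rule sum_nonneg) (use q x inB R(1) in \<open>auto intro!: gain_nonneg\<close>)
  ultimately have 1: "gain q (R (b \<otimes> x)) \<le> p * (\<Sum>t\<in>B'. gain q (R (t \<otimes> x)))"
    using mult_right_mono[OF \<open>1 \<le> p\<close> g0] by simp
  have nonneg: "0 \<le> gain p (1 / R (s \<otimes> (t \<otimes> x))) + (M - R (s \<otimes> (t \<otimes> x)))"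
    if "s \<in> A'" "t \<in> B'" for s t
    using that x inA inB R(1)[of "s \<otimes> (t \<otimes> x)"] M[of "s \<otimes> (t \<otimes> x)"] p
      gain_nonneg[of p "1 / R (s \<otimes> (t \<otimes> x))"] by simp
  have "gain p (1 / R (a \<otimes> (b \<otimes> x))) + (M - R (a \<otimes> (b \<otimes> x)))
      \<le> (\<Sum>s\<in>A'. gain p (1 / R (s \<otimes> (b \<otimes> x))) + (M - R (s \<otimes> (b \<otimes> x))))"
    by (rule member_le_sum[where f = "\<lambda>s. gain p (1 / R (s \<otimes> (b \<otimes> x))) + (M - R (s \<otimes> (b \<otimes> x)))"])
       (use a b fin nonneg in \<open>auto simp: A'_def B'_def\<close>)
  also have "\<dots> \<le> (\<Sum>t\<in>B'. \<Sum>s\<in>A'. gain p (1 / R (s \<otimes> (t \<otimes> x))) + (M - R (s \<otimes> (t \<otimes> x))))"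
    by (rule member_le_sum[where f = "\<lambda>t. \<Sum>s\<in>A'. gain p (1 / R (s \<otimes> (t \<otimes> x))) + (M - R (s \<otimes> (t \<otimes> x)))"])
       (use b fin nonneg in \<open>auto simp: B'_def intro!: sum_nonneg\<close>)
  finally show ?thesis
    using 1 total by linarith
qed

lemma psi_decreases_in_step:
  assumes pair: "superharmonic_pair G A B \<rho> \<phi> \<psi>"
    and x: "x \<in> carrier G" and a: "a \<in> A" and b: "b \<in> B"
    and R_def: "R = (\<lambda>x. \<phi> x / \<psi> x)"
    and lt: "R (b \<otimes> x) < 1" "1 / R (a \<otimes> (b \<otimes> x)) < 1"
  shows "\<psi> (a \<otimes> (b \<otimes> x)) < \<psi> x"
proof -
  have y: "b \<otimes> x \<in> carrier G" "a \<otimes> (b \<otimes> x) \<in> carrier G"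
    using x a b A.in_carrier B.in_carrier by auto
  note P = pair[unfolded superharmonic_pair_def, rule_format]
  have "\<psi> (a \<otimes> (b \<otimes> x)) < \<phi> (a \<otimes> (b \<otimes> x))"
    using lt(2) P[OF y(2)] by (simp add: R_def)
  also have "\<dots> = \<phi> (b \<otimes> x)"
    using P[OF y(1)] a by simp
  also have "\<dots> < \<psi> (b \<otimes> x)"
    using lt(1) P[OF y(1)] by (simp add: R_def)
  also have "\<dots> = \<psi> x"
    using P[OF x] b by simp
  finally show ?thesis .
qed

text \<open>The number \<open>2 * \<epsilon> + (M - R x)\<close> grows by at most the factor
  \<open>p * q + 1\<close> in each step, by \<open>superharmonic_path_step\<close>. If it is small at the start,
  it stays small, and so do the gains, which by \<open>gain_ge\<close> forces \<open>\<psi>\<close> to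
  decrease.\<close>

lemma psi_decreases_along_path:
  fixes p q \<epsilon> \<kappa> :: real
  assumes pair: "superharmonic_pair G A B \<rho> \<phi> \<psi>"
    and M: "\<And>x. x \<in> carrier G \<Longrightarrow> \<phi> x / \<psi> x \<le> M"
    and p_def: "p = card A - 1" and q_def: "q = card B - 1"
    and pq: "1 \<le> p" "1 \<le> q"
    and \<epsilon>: "\<rho> \<le> sqrt p + sqrt q + \<epsilon>" "0 \<le> \<epsilon>"
    and \<kappa>: "\<kappa> \<le> (sqrt p - 1)\<^sup>2" "\<kappa> \<le> (sqrt q - 1)\<^sup>2"
    and ws: "set ws \<subseteq> (A - {\<one>}) \<times> (B - {\<one>})"
    and x: "x \<in> carrier G"
    and small: "(p * q + 1) ^ length ws * (2 * \<epsilon> + (M - \<phi> x / \<psi> x)) < \<kappa>"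
  shows "\<psi> (fold (path_step G) ws x) \<le> \<psi> x \<and> (ws \<noteq> [] \<longrightarrow> \<psi> (fold (path_step G) ws x) < \<psi> x)"
  using ws x small
proof (induction ws arbitrary: x)
  case (Cons w ws)
  obtain a b where w: "w = (a, b)" "a \<in> A - {\<one>}" "b \<in> B - {\<one>}"
    using Cons.prems(1) by (cases w) auto
  define R where "R = (\<lambda>x. \<phi> x / \<psi> x)"
  define E where "E y = 2 * \<epsilon> + (M - R y)" for y
  define y where "y = a \<otimes> (b \<otimes> x)"
  have bx: "b \<otimes> x \<in> carrier G" and y: "y \<in> carrier G"
    using w Cons.prems A.in_carrier B.in_carrier by (auto simp: y_def)
  have R: "0 < R z" if "z \<in> carrier G" for z
    using pair that by (simp add: superharmonic_pair_def R_def)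
  have E_ge: "2 * \<epsilon> \<le> E z" if "z \<in> carrier G" for z
    using M[OF that] by (simp add: E_def R_def)
  have step: "gain q (R (b \<otimes> x)) + gain p (1 / R y) + (M - R y) \<le> p * q * E x"
    using superharmonic_path_step[OF pair M Cons.prems(2) w(2,3) p_def q_def \<epsilon>(1) R_def]
    by (simp add: E_def y_def)
  have R_le: "R y \<le> M"
    using M[OF y] by (simp add: R_def)
  have g: "0 \<le> gain q (R (b \<otimes> x))" "0 \<le> gain p (1 / R y)" "0 \<le> M - R y"
    using gain_nonneg[of q "R (b \<otimes> x)"] gain_nonneg[of p "1 / R y"] R[OF bx] R[OF y] pq R_le
    by simp_all
  have Ex: "0 \<le> E x"
    using E_ge[OF Cons.prems(2)] \<epsilon>(2) by linarith
  have pqE: "p * q * E x \<le> (p * q + 1) * E x"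
    using Ex by (intro mult_right_mono) auto
  have pow: "1 \<le> (p * q + 1) ^ length ws"
    using pq by (intro one_le_power) simp
  have small: "(p * q + 1) ^ length ws * ((p * q + 1) * E x) < \<kappa>"
    using Cons.prems(3) by (simp add: E_def R_def mult_ac)
  moreover have "1 * ((p * q + 1) * E x) \<le> (p * q + 1) ^ length ws * ((p * q + 1) * E x)"
    using pow Ex pq by (intro mult_right_mono) auto
  ultimately have lt: "gain q (R (b \<otimes> x)) < \<kappa>" "gain p (1 / R y) < \<kappa>"
    using step g pqE by linarith+
  have "R (b \<otimes> x) < 1"
    using gain_ge[OF pq(2), of "R (b \<otimes> x)"] lt(1) \<kappa>(2) by fastforce
  moreover have "1 / R y < 1"
    using gain_ge[OF pq(1), of "1 / R y"] lt(2) \<kappa>(1) by fastforce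
  ultimately have dec: "\<psi> y < \<psi> x"
    unfolding y_def using psi_decreases_in_step[OF pair Cons.prems(2) _ _ R_def] w by auto
  have "E y \<le> (p * q + 1) * E x"
    using step g E_ge[OF Cons.prems(2)] by (simp add: E_def[of y] algebra_simps)
  then have "(p * q + 1) ^ length ws * E y \<le> (p * q + 1) ^ length ws * ((p * q + 1) * E x)"
    using pow by (intro mult_left_mono) auto
  then have "(p * q + 1) ^ length ws * (2 * \<epsilon> + (M - \<phi> y / \<psi> y)) < \<kappa>"
    using small by (simp add: E_def R_def)
  then have "\<psi> (fold (path_step G) ws y) \<le> \<psi> y"
    using Cons.IH[OF _ y] Cons.prems(1) by auto
  then show ?case
    using dec by (simp add: w(1) y_def)
qed simp

lemma fold_path_step:
  assumes "set ws \<subseteq> A \<times> B" "x \<in> carrier G" "y \<in> carrier G"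
  shows "fold (path_step G) ws (x \<otimes> y) = fold (path_step G) ws x \<otimes> y"
  using assms
proof (induction ws arbitrary: x)
  case (Cons w ws)
  obtain a b where w: "w = (a, b)" "a \<in> carrier G" "b \<in> carrier G"
    using Cons.prems A.in_carrier B.in_carrier by (cases w) auto
  then show ?case
    using Cons.prems Cons.IH[of "a \<otimes> (b \<otimes> x)"] by (simp add: A.m_assoc)
qed simp

text \<open>The left-hand side is the norm in the free product of \<open>A\<close> and \<open>B\<close>. If
  \<open>\<rho>\<close> were almost as small as there, then \<open>\<psi>\<close> would decrease along the
  reduced word \<open>ws\<close>, given as a list of syllables \<open>(a, b)\<close>; but this word leads back
  to its start. The bounds on the cardinalities make the constant in \<open>gain_ge\<close> positive at both
  kinds of vertices.\<close>

theorem prod_norm_gt_of_relation: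
  assumes ws: "ws \<noteq> []" "set ws \<subseteq> (A - {\<one>}) \<times> (B - {\<one>})"
    and loop: "fold (path_step G) ws \<one> = \<one>"
    and card: "3 \<le> card A" "3 \<le> card B"
  shows "sqrt (card A * card B) * (sqrt (card A - 1) + sqrt (card B - 1)) < prod_norm"
proof (rule ccontr)
  define p q where "p = real (card A - 1)" and "q = real (card B - 1)"
  have pq: "1 < p" "1 < q"
    using card by (auto simp: p_def q_def)
  define \<kappa> where "\<kappa> = min ((sqrt p - 1)\<^sup>2) ((sqrt q - 1)\<^sup>2)"
  have \<kappa>: "0 < \<kappa>" "\<kappa> \<le> (sqrt p - 1)\<^sup>2" "\<kappa> \<le> (sqrt q - 1)\<^sup>2"
    using pq by (auto simp: \<kappa>_def)
  define K where "K = (p * q + 1) ^ length ws"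
  have K: "0 < K"
    unfolding K_def using pq by (intro zero_less_power) (simp add: add_pos_pos)
  \<comment> \<open>At a start where \<open>R\<close> differs from its supremum by less than \<open>\<epsilon>\<close>, the number controlled in
    \<open>psi_decreases_along_path\<close> is below \<open>3 * \<epsilon>\<close>.\<close>
  define \<epsilon> where "\<epsilon> = \<kappa> / (4 * K)"
  have \<epsilon>: "0 < \<epsilon>" "K * (3 * \<epsilon>) < \<kappa>"
    using \<kappa> K by (auto simp: \<epsilon>_def)
  assume "\<not> sqrt (card A * card B) * (sqrt (card A - 1) + sqrt (card B - 1)) < prod_norm"
  then have "prod_norm \<le> sqrt (card A * card B) * (sqrt p + sqrt q)"
    by (simp add: p_def q_def)
  also have "\<dots> < sqrt (card A * card B) * (sqrt p + sqrt q + \<epsilon>)"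
    using card \<epsilon>(1) by (intro mult_strict_left_mono) auto
  finally obtain \<phi> \<psi> where pair: "superharmonic_pair G A B (sqrt p + sqrt q + \<epsilon>) \<phi> \<psi>"
    by (rule superharmonic_pair_exists)
  define R where "R = (\<lambda>x. \<phi> x / \<psi> x)"
  define M where "M = (SUP x\<in>carrier G. R x)"
  have "R x \<le> sqrt p + sqrt q + \<epsilon>" if "x \<in> carrier G" for x
  proof -
    have "R y \<ge> 0" if "y \<in> carrier G" for y
      using pair that by (simp add: superharmonic_pair_def R_def less_imp_le)
    then have "R x \<le> orbit_sum G B R x"
      using that by (rule B.orbit_sum_ge_self)
    also have "\<dots> \<le> sqrt p + sqrt q + \<epsilon>"
      using superharmonic_pair_edge_weight[OF pair] that by (simp add: edge_weight_def R_def)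
    finally show ?thesis .
  qed
  then have bdd: "bdd_above (R ` carrier G)"
    by (rule bdd_aboveI2)
  have M: "R x \<le> M" if "x \<in> carrier G" for x
    unfolding M_def by (rule cSUP_upper[OF that bdd])
  have "carrier G \<noteq> {}"
    using A.in_carrier[OF A.one_mem] by blast
  moreover have "M - \<epsilon> < M"
    using \<epsilon>(1) by simp
  ultimately obtain x where x: "x \<in> carrier G" "M - \<epsilon> < R x"
    unfolding M_def using less_cSUP_iff[OF _ bdd] by metis
  have "K * (2 * \<epsilon> + (M - R x)) \<le> K * (3 * \<epsilon>)"
    using x(2) K by (intro mult_left_mono) auto
  then have "(p * q + 1) ^ length ws * (2 * \<epsilon> + (M - \<phi> x / \<psi> x)) < \<kappa>"
    using \<epsilon>(2) by (simp add: K_def R_def)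
  moreover have "p = card A - 1" "q = card B - 1"
    by (simp_all add: p_def q_def)
  ultimately have "\<psi> (fold (path_step G) ws x) < \<psi> x"
    using psi_decreases_along_path[OF pair M[unfolded R_def], of p q \<epsilon> \<kappa> ws x]
      pq \<epsilon>(1) \<kappa> ws x(1) by auto
  moreover have "fold (path_step G) ws x = x"
    using fold_path_step[of ws \<one> x] ws(2) loop x(1) by auto
  ultimately show False
    by simp
qed

end

section \<open>Averaging an edge weight over an amenable subgroup\<close>

locale finitely_additive_probability =
  fixes X :: "'a set" and \<mu> :: "'a set \<Rightarrow> real"
  assumes nonneg: "A \<subseteq> X \<Longrightarrow> 0 \<le> \<mu> A"
    and additive: "additive (Pow X) \<mu>"
    and total: "\<mu> X = 1"
begin

text \<open>The integral with respect to a finitely additive measure, for functions with finite range on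
  \<open>X\<close>.\<close>

definition mean :: "('a \<Rightarrow> real) \<Rightarrow> real" where
  "mean f = (\<Sum>v\<in>f ` X. v * \<mu> {x \<in> X. f x = v})"

lemma measure_fibres:
  assumes "finite W"
  shows "\<mu> {x \<in> X. J x \<in> W} = (\<Sum>w\<in>W. \<mu> {x \<in> X. J x = w})"
  using assms
proof (induction W rule: finite_induct)
  case empty
  have "\<mu> ({} \<union> {}) = \<mu> {} + \<mu> {}"
    by (rule additiveD[OF additive]) auto
  then show ?case by simp
next
  case (insert w W)
  have "{x \<in> X. J x \<in> insert w W} = {x \<in> X. J x = w} \<union> {x \<in> X. J x \<in> W}"
    by auto
  also have "\<mu> \<dots> = \<mu> {x \<in> X. J x = w} + \<mu> {x \<in> X. J x \<in> W}"
    by (rule additiveD[OF additive]) (use insert.hyps in auto)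
  finally show ?case
    using insert by simp
qed

lemma mean_compose:
  assumes "finite (J ` X)"
  shows "mean (\<lambda>x. F (J x)) = (\<Sum>w\<in>J ` X. F w * \<mu> {x \<in> X. J x = w})"
proof -
  have "\<mu> {x \<in> X. F (J x) = v} = (\<Sum>w | w \<in> J ` X \<and> F w = v. \<mu> {x \<in> X. J x = w})" for v
  proof -
    have "{x \<in> X. F (J x) = v} = {x \<in> X. J x \<in> {w \<in> J ` X. F w = v}}"
      by auto
    then show ?thesis
      using measure_fibres[of "{w \<in> J ` X. F w = v}" J] assms by simp
  qed
  then have "mean (\<lambda>x. F (J x))
      = (\<Sum>v\<in>F ` J ` X. \<Sum>w | w \<in> J ` X \<and> F w = v. F w * \<mu> {x \<in> X. J x = w})"
    unfolding mean_def image_image sum_distrib_left[symmetric]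
    by (intro sum.cong refl) (auto simp: sum_distrib_left)
  also have "\<dots> = (\<Sum>w\<in>J ` X. F w * \<mu> {x \<in> X. J x = w})"
    by (rule sum.image_gen[OF assms, symmetric])
  finally show ?thesis .
qed

lemma mean_cong:
  assumes "\<And>x. x \<in> X \<Longrightarrow> f x = g x"
  shows "mean f = mean g"
proof -
  have "f ` X = g ` X"
    by (rule image_cong) (use assms in auto)
  moreover have "{x \<in> X. f x = v} = {x \<in> X. g x = v}" for v
    using assms by auto
  ultimately show ?thesis
    by (simp add: mean_def)
qed

lemma finite_pair: "finite (f ` X) \<Longrightarrow> finite (g ` X) \<Longrightarrow> finite ((\<lambda>x. (f x, g x)) ` X)"
  by (rule finite_subset[of _ "f ` X \<times> g ` X"]) auto

lemma mean_add:
  assumes "finite (f ` X)" "finite (g ` X)"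
  shows "mean (\<lambda>x. f x + g x) = mean f + mean g"
  using mean_compose[OF finite_pair[OF assms], of "\<lambda>(v, w). v + w"]
    mean_compose[OF finite_pair[OF assms], of fst] mean_compose[OF finite_pair[OF assms], of snd]
  by (simp add: case_prod_beta distrib_right sum.distrib)

lemma mean_cmult:
  assumes "finite (f ` X)"
  shows "mean (\<lambda>x. c * f x) = c * mean f"
  using mean_compose[OF assms, of "\<lambda>v. c * v"]
  by (simp add: mean_def sum_distrib_left mult.assoc)

lemma mean_mono:
  assumes "finite (f ` X)" "finite (g ` X)" "\<And>x. x \<in> X \<Longrightarrow> f x \<le> g x"
  shows "mean f \<le> mean g"
proof -
  have "mean f = (\<Sum>w\<in>(\<lambda>x. (f x, g x)) ` X. fst w * \<mu> {x \<in> X. (f x, g x) = w})"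
    using mean_compose[OF finite_pair[OF assms(1,2)], of fst] by simp
  also have "\<dots> \<le> (\<Sum>w\<in>(\<lambda>x. (f x, g x)) ` X. snd w * \<mu> {x \<in> X. (f x, g x) = w})"
    by (intro sum_mono mult_right_mono nonneg) (use assms(3) in auto)
  also have "\<dots> = mean g"
    using mean_compose[OF finite_pair[OF assms(1,2)], of snd] by simp
  finally show ?thesis .
qed

lemma mean_const: "mean (\<lambda>_. c) = c"
proof -
  have "X \<noteq> {}"
    using total measure_fibres[of "{}" id] by auto
  then have "(\<lambda>_. c) ` X = {c}"
    by auto
  then show ?thesis
    by (simp add: mean_def total)
qed

lemma finite_range_sum:
  assumes "\<And>i. i \<in> I \<Longrightarrow> finite (f i ` X)"
  shows "finite ((\<lambda>x. \<Sum>i\<in>I. f i x :: real) ` X)"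
  using assms
proof (induction I rule: infinite_finite_induct)
  case (insert i I)
  have "(\<lambda>x. \<Sum>i\<in>insert i I. f i x) ` X
      \<subseteq> (\<lambda>(v, w). v + w) ` (f i ` X \<times> (\<lambda>x. \<Sum>i\<in>I. f i x) ` X)"
    using insert.hyps by auto
  then show ?case
    by (rule finite_subset) (use insert in auto)
qed (auto intro: finite_subset[of _ "{0}"])

lemma mean_sum:
  assumes "\<And>i. i \<in> I \<Longrightarrow> finite (f i ` X)"
  shows "mean (\<lambda>x. \<Sum>i\<in>I. f i x) = (\<Sum>i\<in>I. mean (f i))"
  using assms
  by (induction I rule: infinite_finite_induct) (simp_all add: mean_const mean_add finite_range_sum)

text \<open>Integrate the tangent line bound \<open>1 / y \<ge> 2 / c - y / c\<^sup>2\<close> at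
  \<open>c = mean f\<close>.\<close>

lemma inverse_mean_le:
  assumes f: "finite (f ` X)" and pos: "\<And>x. x \<in> X \<Longrightarrow> 0 < f x" "0 < mean f"
  shows "1 / mean f \<le> mean (\<lambda>x. 1 / f x)"
proof -
  define c where "c = mean f"
  have c: "0 < c"
    using pos by (simp add: c_def)
  have fin: "finite ((\<lambda>x. F (f x)) ` X)" for F :: "real \<Rightarrow> real"
    using finite_imageI[OF f, of F] by (simp add: image_image)
  have "1 / c = mean (\<lambda>_. 2 / c) + (- 1 / c\<^sup>2) * mean f"
    unfolding mean_const c_def[symmetric] using c by (simp add: field_simps power2_eq_square)
  also have "\<dots> = mean (\<lambda>x. 2 / c + (- 1 / c\<^sup>2) * f x)"
    by (simp only: mean_cmult[OF f, symmetric] mean_add[OF fin[of "\<lambda>_. 2 / c"] fin])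
  also have "\<dots> \<le> mean (\<lambda>x. 1 / f x)"
  proof (rule mean_mono[OF fin fin])
    fix x assume "x \<in> X"
    then have "0 < f x"
      by (rule pos)
    have "0 \<le> (f x - c)\<^sup>2 / (f x * c\<^sup>2)"
      using \<open>0 < f x\<close> by simp
    also have "\<dots> = 1 / f x - (2 / c + (- 1 / c\<^sup>2) * f x)"
      using \<open>0 < f x\<close> c by (simp add: field_simps power2_eq_square)
    finally show "2 / c + (- 1 / c\<^sup>2) * f x \<le> 1 / f x"
      by simp
  qed
  finally show ?thesis
    by (simp add: c_def)
qed

lemma mean_invariant:
  assumes "bij_betw g X X" "\<And>A. A \<subseteq> X \<Longrightarrow> \<mu> (g ` A) = \<mu> A"
  shows "mean (\<lambda>x. f (g x)) = mean f"
proof -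
  have "\<mu> {x \<in> X. f (g x) = v} = \<mu> {x \<in> X. f x = v}" for v
  proof -
    have "g ` {x \<in> X. f (g x) = v} = {x \<in> X. f x = v}"
      using assms(1) by (auto simp: bij_betw_def)
    then show ?thesis
      using assms(2)[of "{x \<in> X. f (g x) = v}"] by simp
  qed
  moreover have "(\<lambda>x. f (g x)) ` X = f ` X"
    using assms(1) by (metis bij_betw_imp_surj_on image_image)
  ultimately show ?thesis
    by (simp add: mean_def)
qed

end

context finite_subgroup_pair
begin

text \<open>Averaging preserves the condition on \<open>R\<close> since it is linear, and the one on
  \<open>1 / R\<close> since the inverse of a mean is at most the mean of the inverses. To have a finite range,
  \<open>R\<close> is first rounded up to multiples of \<open>\<delta>\<close>, which lowers
  \<open>1 / R\<close> and costs at most \<open>card B * \<delta>\<close> in the other condition.\<close>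

theorem edge_weight_average:
  fixes \<delta> :: real
  assumes R: "edge_weight G A B \<rho> R" and H: "subgroup H G"
    and am: "amenable (G\<lparr>carrier := H\<rparr>)" and \<delta>: "0 < \<delta>"
  obtains R' where "edge_weight G A B (\<rho> + card B * \<delta>) R'"
    "\<And>x h. x \<in> carrier G \<Longrightarrow> h \<in> H \<Longrightarrow> R' (x \<otimes> h) = R' x"
proof -
  obtain \<mu> :: "'a set \<Rightarrow> real" where
      "\<forall>S. S \<subseteq> carrier (G\<lparr>carrier := H\<rparr>) \<longrightarrow> \<mu> S \<in> {0..1}"
      "additive (Pow (carrier (G\<lparr>carrier := H\<rparr>))) \<mu>" "\<mu> (carrier (G\<lparr>carrier := H\<rparr>)) = 1"
      "\<forall>h\<in>carrier (G\<lparr>carrier := H\<rparr>). \<forall>S. S \<subseteq> carrier (G\<lparr>carrier := H\<rparr>) \<longrightarrow>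
        \<mu> (h <#\<^bsub>G\<lparr>carrier := H\<rparr>\<^esub> S) = \<mu> S"
    using am unfolding amenable_def by blast
  moreover have "h <#\<^bsub>G\<lparr>carrier := H\<rparr>\<^esub> S = (\<lambda>x. h \<otimes> x) ` S" for h S
    by (auto simp: l_coset_def)
  ultimately have \<mu>: "\<And>S. S \<subseteq> H \<Longrightarrow> 0 \<le> \<mu> S" "additive (Pow H) \<mu>" "\<mu> H = 1"
    and inv: "\<And>h S. h \<in> H \<Longrightarrow> S \<subseteq> H \<Longrightarrow> \<mu> ((\<lambda>x. h \<otimes> x) ` S) = \<mu> S"
    by simp_all
  interpret finitely_additive_probability H \<mu>
    using \<mu> by unfold_locales auto
  interpret H: subgroup H G
    by (rule H)
  have Hc: "h \<in> carrier G" if "h \<in> H" for h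
    using that H.subset by blast
  have R: "0 < R x" "orbit_sum G A (\<lambda>y. 1 / R y) x \<le> \<rho>" "orbit_sum G B R x \<le> \<rho>"
    if "x \<in> carrier G" for x
    using R that by (auto simp: edge_weight_def)
  have R_le: "R x \<le> \<rho>" if x: "x \<in> carrier G" for x
    using B.orbit_sum_ge_self[of R x] R(1,3) x by (force simp: less_imp_le)
  have R_ge: "1 / R x \<le> \<rho>" if x: "x \<in> carrier G" for x
    using A.orbit_sum_ge_self[of "\<lambda>y. 1 / R y" x] R(1,2) x by (force simp: less_imp_le)
  define r where "r x = \<delta> * of_int \<lceil>R x / \<delta>\<rceil>" for x
  have r: "R x \<le> r x" "r x \<le> R x + \<delta>" for x
  proof -
    have "R x / \<delta> * \<delta> \<le> of_int \<lceil>R x / \<delta>\<rceil> * \<delta>"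
      using \<delta> by (intro mult_right_mono) auto
    then show "R x \<le> r x"
      using \<delta> by (simp add: r_def mult.commute)
    have "of_int \<lceil>R x / \<delta>\<rceil> * \<delta> \<le> (R x / \<delta> + 1) * \<delta>"
      using \<delta> by (intro mult_right_mono) linarith+
    then show "r x \<le> R x + \<delta>"
      using \<delta> by (simp add: r_def algebra_simps)
  qed
  have "r ` carrier G \<subseteq> (\<lambda>k. \<delta> * of_int k) ` {0..\<lceil>\<rho> / \<delta>\<rceil>}"
  proof (rule image_subsetI)
    fix x assume x: "x \<in> carrier G"
    have "0 < R x / \<delta>" "R x / \<delta> \<le> \<rho> / \<delta>"
      using R(1)[OF x] R_le[OF x] \<delta> by (auto simp: divide_right_mono)
    then have "\<lceil>R x / \<delta>\<rceil> \<in> {0..\<lceil>\<rho> / \<delta>\<rceil>}"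
      using ceiling_mono[of "R x / \<delta>" "\<rho> / \<delta>"] by (simp add: less_imp_le order_less_le_trans)
    then show "r x \<in> (\<lambda>k. \<delta> * of_int k) ` {0..\<lceil>\<rho> / \<delta>\<rceil>}"
      by (auto simp: r_def)
  qed
  then have fin_r: "finite (r ` carrier G)"
    by (rule finite_subset) simp
  have fin: "finite ((\<lambda>h. F (r (x \<otimes> h))) ` H)" if "x \<in> carrier G" for x and F :: "real \<Rightarrow> real"
    by (rule finite_subset[OF _ finite_imageI[OF fin_r, of F]]) (use that Hc in auto)
  have rpos: "0 < r x" if "x \<in> carrier G" for x
    using R(1)[OF that] r(1)[of x] by linarith
  define R' where "R' x = mean (\<lambda>h. r (x \<otimes> h))" for x
  have \<rho>: "0 < \<rho>"
    using R(1) R_le A.in_carrier[OF A.one_mem] by (meson order_less_le_trans)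
  have R'pos: "0 < R' x" if x: "x \<in> carrier G" for x
  proof -
    have "mean (\<lambda>_. 1 / \<rho>) \<le> R' x"
      unfolding R'_def
    proof (rule mean_mono)
      fix h assume "h \<in> H"
      then have xh: "x \<otimes> h \<in> carrier G"
        using x Hc by simp
      have "1 / \<rho> \<le> R (x \<otimes> h)"
        using R_ge[OF xh] R(1)[OF xh] \<rho> by (simp add: field_simps)
      then show "1 / \<rho> \<le> r (x \<otimes> h)"
        using r(1)[of "x \<otimes> h"] by linarith
    qed (use fin[OF x, of "\<lambda>v. v"] in \<open>auto intro: finite_subset[of _ "{1 / \<rho>}"]\<close>)
    then show ?thesis
      unfolding mean_const using \<rho> by (meson order_less_le_trans zero_less_divide_1_iff)
  qed
  have "edge_weight G A B (\<rho> + card B * \<delta>) R'"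
    unfolding edge_weight_def
  proof (intro ballI conjI)
    fix x assume x: "x \<in> carrier G"
    show "0 < R' x"
      by (rule R'pos[OF x])
    have "orbit_sum G B R' x = mean (\<lambda>h. \<Sum>b\<in>B. r ((b \<otimes> x) \<otimes> h))"
      unfolding orbit_sum_def R'_def
      by (rule mean_sum[symmetric]) (use x B.in_carrier fin[of _ "\<lambda>v. v"] in auto)
    also have "\<dots> = mean (\<lambda>h. orbit_sum G B r (x \<otimes> h))"
      by (rule mean_cong) (use x B.in_carrier Hc in \<open>auto simp: orbit_sum_def A.m_assoc\<close>)
    also have "\<dots> \<le> mean (\<lambda>_. \<rho> + card B * \<delta>)"
    proof (rule mean_mono)
      fix h assume "h \<in> H"
      then have xh: "x \<otimes> h \<in> carrier G"
        using x Hc by simp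
      have "orbit_sum G B r (x \<otimes> h) \<le> (\<Sum>b\<in>B. R (b \<otimes> (x \<otimes> h)) + \<delta>)"
        unfolding orbit_sum_def by (rule sum_mono) (rule r(2))
      also have "\<dots> = orbit_sum G B R (x \<otimes> h) + card B * \<delta>"
        by (simp add: orbit_sum_def sum.distrib)
      finally show "orbit_sum G B r (x \<otimes> h) \<le> \<rho> + card B * \<delta>"
        using R(3)[OF xh] by linarith
    next
      have "finite ((\<lambda>h. \<Sum>b\<in>B. r ((b \<otimes> x) \<otimes> h)) ` H)"
        by (rule finite_range_sum) (use x B.in_carrier fin[of _ "\<lambda>v. v"] in auto)
      moreover have "(\<lambda>h. orbit_sum G B r (x \<otimes> h)) ` H = (\<lambda>h. \<Sum>b\<in>B. r ((b \<otimes> x) \<otimes> h)) ` H"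
        by (rule image_cong) (use x B.in_carrier Hc in \<open>auto simp: orbit_sum_def A.m_assoc\<close>)
      ultimately show "finite ((\<lambda>h. orbit_sum G B r (x \<otimes> h)) ` H)"
        by simp
    qed (auto intro: finite_subset[of _ "{\<rho> + card B * \<delta>}"])
    finally show "orbit_sum G B R' x \<le> \<rho> + card B * \<delta>"
      by (simp add: mean_const)
    have "orbit_sum G A (\<lambda>y. 1 / R' y) x \<le> (\<Sum>a\<in>A. mean (\<lambda>h. 1 / r ((a \<otimes> x) \<otimes> h)))"
      unfolding orbit_sum_def R'_def
      by (intro sum_mono inverse_mean_le)
         (use x A.in_carrier fin[of _ "\<lambda>v. v"] Hc rpos R'pos in \<open>auto simp: R'_def\<close>)
    also have "\<dots> = mean (\<lambda>h. \<Sum>a\<in>A. 1 / r ((a \<otimes> x) \<otimes> h))"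
      by (rule mean_sum[symmetric]) (use x A.in_carrier fin[of _ "\<lambda>v. 1 / v"] in auto)
    also have "\<dots> \<le> mean (\<lambda>_. \<rho>)"
    proof (rule mean_mono)
      fix h assume "h \<in> H"
      then have xh: "x \<otimes> h \<in> carrier G" and h: "h \<in> carrier G"
        using x Hc by simp_all
      have "(\<Sum>a\<in>A. 1 / r ((a \<otimes> x) \<otimes> h)) \<le> orbit_sum G A (\<lambda>y. 1 / R y) (x \<otimes> h)"
        unfolding orbit_sum_def
      proof (rule sum_mono)
        fix a assume a: "a \<in> A"
        have "a \<otimes> (x \<otimes> h) \<in> carrier G"
          using a A.in_carrier xh by simp
        then show "1 / r ((a \<otimes> x) \<otimes> h) \<le> 1 / R (a \<otimes> (x \<otimes> h))"
          using a A.in_carrier x h r(1) R(1) rpos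
          by (simp add: A.m_assoc frac_le)
      qed
      then show "(\<Sum>a\<in>A. 1 / r ((a \<otimes> x) \<otimes> h)) \<le> \<rho>"
        using R(2)[OF xh] by linarith
    next
      show "finite ((\<lambda>h. \<Sum>a\<in>A. 1 / r ((a \<otimes> x) \<otimes> h)) ` H)"
        by (rule finite_range_sum) (use x A.in_carrier fin[of _ "\<lambda>v. 1 / v"] in auto)
    qed (auto intro: finite_subset[of _ "{\<rho>}"])
    finally show "orbit_sum G A (\<lambda>y. 1 / R' y) x \<le> \<rho> + card B * \<delta>"
      using \<delta> by (simp add: mean_const add_increasing2)
  qed
  moreover have "R' (x \<otimes> h) = R' x" if x: "x \<in> carrier G" and h: "h \<in> H" for x h
  proof -
    have "bij_betw (\<lambda>k. h \<otimes> k) H H"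
      by (rule bij_betw_byWitness[where f' = "\<lambda>k. inv h \<otimes> k"])
         (use h Hc in \<open>auto simp: A.m_assoc[symmetric]\<close>)
    then have "mean (\<lambda>k. r (x \<otimes> (h \<otimes> k))) = R' x"
      unfolding R'_def by (rule mean_invariant[where f = "\<lambda>k. r (x \<otimes> k)"]) (rule inv[OF h])
    moreover have "R' (x \<otimes> h) = mean (\<lambda>k. r (x \<otimes> (h \<otimes> k)))"
      unfolding R'_def by (rule mean_cong) (use x h Hc in \<open>simp add: A.m_assoc\<close>)
    ultimately show ?thesis
      by simp
  qed
  ultimately show thesis
    by (rule that)
qed

end

section \<open>Piecewise affine maps of the circle\<close>

abbreviation inverse_map :: "('a \<Rightarrow> 'b) \<Rightarrow> 'b \<Rightarrow> 'a" where
  "inverse_map \<equiv> inv_into UNIV"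

lemma circle_cases:
  obtains t where "0 \<le> t" "t < 1" "p = circ t"
proof -
  obtain x where "p = circ x"
    by (induction p rule: circle.abs_induct) blast
  moreover have "circ x = circ (frac x)"
    by (simp add: circ_eq_iff frac_def)
  ultimately have "p = circ (frac x)"
    by metis
  then show thesis
    by (rule that[OF frac_ge_0 frac_lt_1])
qed

lemma circ_eq_imp_eq:
  assumes "circ x = circ y" "\<bar>x - y\<bar> < 1"
  shows "x = y"
proof -
  obtain k :: int where k: "x - y = of_int k"
    using assms(1) by (auto simp: circ_eq_iff elim: Ints_cases)
  then have "\<bar>k\<bar> < 1"
    using assms(2) by linarith
  then show ?thesis
    using k by simp
qed

lemma circ_plus_int [simp]: "circ (x + of_int k) = circ x"
  by (simp add: circ_eq_iff)

lemma circ_minus_int [simp]: "circ (x - of_int k) = circ x"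
  by (simp add: circ_eq_iff)

text \<open>Affinity at a point may be tested with any real number that represents it, since changing the
  representative by an integer only translates the parameter.\<close>

lemma affine_at_circ_iff:
  "affine_at f (circ x) s \<longleftrightarrow>
     (\<exists>y e. 0 < e \<and> (\<forall>t. \<bar>t - x\<bar> < e \<longrightarrow> f (circ t) = circ (y + s * (t - x))))"
proof
  assume "affine_at f (circ x) s"
  then obtain x0 y e where x0: "circ x = circ x0" and e: "0 < e"
    and f: "\<And>t. \<bar>t - x0\<bar> < e \<Longrightarrow> f (circ t) = circ (y + s * (t - x0))"
    unfolding affine_at_def eventually_nhds_metric dist_real_def by metis
  obtain k where k: "x - x0 = of_int k"
    using x0 by (auto simp: circ_eq_iff elim: Ints_cases)
  have "f (circ t) = circ (y + s * (t - x))" if "\<bar>t - x\<bar> < e" for t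
  proof -
    have "circ t = circ (t - of_int k)"
      by (simp add: circ_eq_iff)
    moreover have eq: "t - of_int k - x0 = t - x"
      using k by simp
    ultimately show ?thesis
      using f[of "t - of_int k", unfolded eq] that by simp
  qed
  then show "\<exists>y e. 0 < e \<and> (\<forall>t. \<bar>t - x\<bar> < e \<longrightarrow> f (circ t) = circ (y + s * (t - x)))"
    using e by blast
next
  assume "\<exists>y e. 0 < e \<and> (\<forall>t. \<bar>t - x\<bar> < e \<longrightarrow> f (circ t) = circ (y + s * (t - x)))"
  then show "affine_at f (circ x) s"
    unfolding affine_at_def eventually_nhds_metric dist_real_def by blast
qed

lemma affine_atE:
  assumes "affine_at f p s"
  obtains x y e where "p = circ x" "f p = circ y" "0 < e"
    "\<And>t. \<bar>t - x\<bar> < e \<Longrightarrow> f (circ t) = circ (y + s * (t - x))"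
proof -
  obtain x where x: "p = circ x"
    by (rule circle_cases)
  then obtain y e where "0 < e" "\<And>t. \<bar>t - x\<bar> < e \<Longrightarrow> f (circ t) = circ (y + s * (t - x))"
    using assms affine_at_circ_iff by blast
  moreover from this have "f p = circ y"
    using x by simp
  ultimately show thesis
    using that x by blast
qed

lemma affine_at_interval:
  assumes "\<And>t. a < t \<Longrightarrow> t < b \<Longrightarrow> f (circ t) = circ (k + s * t)" "a < x" "x < b"
  shows "affine_at f (circ x) s"
  unfolding affine_at_circ_iff
proof (intro exI conjI allI impI)
  show "0 < min (x - a) (b - x)"
    using assms by simp
next
  fix t assume "\<bar>t - x\<bar> < min (x - a) (b - x)"
  then have "a < t" "t < b"
    by auto
  then show "f (circ t) = circ ((k + s * x) + s * (t - x))"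
    using assms(1) by (simp add: algebra_simps)
qed

text \<open>Two local affine representations differ by an integer at all nearby points, hence by a
  constant.\<close>

lemma affine_at_unique:
  assumes "affine_at f p s" "affine_at f p s'"
  shows "s = s'"
proof (rule ccontr)
  assume ne: "s \<noteq> s'"
  obtain x y e where x: "p = circ x" and y: "f p = circ y" and e: "0 < e"
    and f: "\<And>t. \<bar>t - x\<bar> < e \<Longrightarrow> f (circ t) = circ (y + s * (t - x))"
    using affine_atE[OF assms(1)] by metis
  obtain y' e' where e': "0 < e'"
    and f': "\<And>t. \<bar>t - x\<bar> < e' \<Longrightarrow> f (circ t) = circ (y' + s' * (t - x))"
    using assms(2) unfolding x affine_at_circ_iff by blast
  have "circ y = circ y'"
    using f[of x] f'[of x] e e' by simp
  then have yy: "y - y' \<in> \<int>"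
    by (simp add: circ_eq_iff)
  define h where "h = min (min e e') (1 / \<bar>s - s'\<bar>) / 2"
  have h: "0 < h" "h < e" "h < e'" "h \<le> (1 / \<bar>s - s'\<bar>) / 2"
    using e e' ne by (auto simp: h_def)
  have "h * \<bar>s - s'\<bar> \<le> (1 / \<bar>s - s'\<bar>) / 2 * \<bar>s - s'\<bar>"
    by (rule mult_right_mono[OF h(4)]) simp
  then have h4: "h * \<bar>s - s'\<bar> < 1"
    using ne by simp
  have "circ (y + s * h) = circ (y' + s' * h)"
    using f[of "x + h"] f'[of "x + h"] h by simp
  then have "(y + s * h) - (y' + s' * h) - (y - y') \<in> \<int>"
    using yy unfolding circ_eq_iff by (rule Ints_diff)
  also have "(y + s * h) - (y' + s' * h) - (y - y') = (s - s') * h"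
    by (simp add: algebra_simps)
  finally obtain z :: int where "(s - s') * h = of_int z"
    by (rule Ints_cases)
  moreover have "0 < \<bar>(s - s') * h\<bar>" "\<bar>(s - s') * h\<bar> < 1"
    using h(1) h4 ne by (auto simp: abs_mult mult.commute)
  ultimately show False
    by simp
qed

lemma affine_at_nonzero:
  assumes "affine_at f p s" "inj f"
  shows "s \<noteq> 0"
proof
  assume "s = 0"
  then obtain x y e where e: "0 < e" and f: "\<And>t. \<bar>t - x\<bar> < e \<Longrightarrow> f (circ t) = circ y"
    using affine_atE[OF assms(1)] by (metis mult_zero_left add.right_neutral)
  define h where "h = min e 1 / 2"
  have h: "0 < h" "h < e" "h < 1"
    using e by (auto simp: h_def)
  have "f (circ x) = f (circ (x + h))"
    using f[of x] f[of "x + h"] h by simp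
  then have "circ x = circ (x + h)"
    using assms(2) by (simp add: inj_eq)
  then show False
    using circ_eq_imp_eq[of x "x + h"] h by simp
qed

lemma affine_at_compose:
  assumes "affine_at g p s" "affine_at f (g p) s'"
  shows "affine_at (f \<circ> g) p (s' * s)"
proof -
  obtain x y e where x: "p = circ x" and y: "g p = circ y" and e: "0 < e"
    and g: "\<And>t. \<bar>t - x\<bar> < e \<Longrightarrow> g (circ t) = circ (y + s * (t - x))"
    using affine_atE[OF assms(1)] by metis
  obtain y' e' where e': "0 < e'"
    and f: "\<And>t. \<bar>t - y\<bar> < e' \<Longrightarrow> f (circ t) = circ (y' + s' * (t - y))"
    using assms(2) unfolding y affine_at_circ_iff by blast
  show ?thesis
    unfolding x affine_at_circ_iff
  proof (intro exI conjI allI impI)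
    show "0 < min e (e' / (\<bar>s\<bar> + 1))"
      using e e' by simp
  next
    fix t assume t: "\<bar>t - x\<bar> < min e (e' / (\<bar>s\<bar> + 1))"
    have "\<bar>s\<bar> * \<bar>t - x\<bar> \<le> (\<bar>s\<bar> + 1) * \<bar>t - x\<bar>"
      by (rule mult_right_mono) auto
    also have "\<dots> < e'"
      using t by (simp add: field_simps)
    finally have "\<bar>s * (t - x)\<bar> < e'"
      by (simp add: abs_mult)
    then show "(f \<circ> g) (circ t) = circ (y' + s' * s * (t - x))"
      using g[of t] f[of "y + s * (t - x)"] t by (simp add: mult.assoc)
  qed
qed

lemma affine_at_inv:
  assumes f: "affine_at f p s" "inj f"
  shows "affine_at (inverse_map f) (f p) (1 / s)"
proof -
  have s: "s \<noteq> 0"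
    using affine_at_nonzero[OF f] .
  obtain x y e where x: "p = circ x" and y: "f p = circ y" and e: "0 < e"
    and f': "\<And>t. \<bar>t - x\<bar> < e \<Longrightarrow> f (circ t) = circ (y + s * (t - x))"
    using affine_atE[OF f(1)] by metis
  show ?thesis
    unfolding y affine_at_circ_iff
  proof (intro exI conjI allI impI)
    show "0 < e * \<bar>s\<bar>"
      using e s by simp
  next
    fix t assume "\<bar>t - y\<bar> < e * \<bar>s\<bar>"
    then have "\<bar>x + 1 / s * (t - y) - x\<bar> < e"
      using s by (simp add: abs_divide divide_less_eq)
    then have "f (circ (x + 1 / s * (t - y))) = circ t"
      using f'[of "x + 1 / s * (t - y)"] s by simp
    then show "inverse_map f (circ t) = circ (x + 1 / s * (t - y))"
      by (rule inv_f_eq[OF f(2)])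
  qed
qed

text \<open>A map that is affine at \<open>p\<close> is affine with the same slope at all nearby points, and
  infinitely many of these are outside of \<open>S\<close>. So the slope may be read off there even if
  \<open>p \<in> S\<close>.\<close>

lemma slope_powi:
  assumes "finite S" "\<And>p. p \<notin> S \<Longrightarrow> \<exists>n :: int. affine_at f p (2 powi n)" "affine_at f p s"
  shows "\<exists>n :: int. s = 2 powi n"
proof -
  obtain x y e where x: "p = circ x" and e: "0 < e"
    and f: "\<And>t. \<bar>t - x\<bar> < e \<Longrightarrow> f (circ t) = circ (y + s * (t - x))"
    using affine_atE[OF assms(3)] by metis
  define I where "I = {x<..<x + min e 1}"
  have "inj_on circ I"
    by (rule inj_onI, rule circ_eq_imp_eq) (auto simp: I_def)
  moreover have "infinite I"
    using e by (simp add: I_def)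
  ultimately have "\<not> circ ` I \<subseteq> S"
    using assms(1) finite_image_iff finite_subset by blast
  then obtain t where "t \<in> I" "circ t \<notin> S"
    by blast
  then have t: "x < t" "t < x + min e 1" "circ t \<notin> S"
    by (simp_all add: I_def)
  then obtain n :: int where n: "affine_at f (circ t) (2 powi n)"
    using assms(2) by blast
  have "affine_at f (circ t) s"
    by (rule affine_at_interval[of x "x + min e 1" f "y - s * x"])
       (use t f in \<open>auto simp: algebra_simps\<close>)
  then show ?thesis
    using affine_at_unique n by blast
qed

lemma breakpoints_iff: "p \<notin> breakpoints f \<longleftrightarrow> (\<exists>s. affine_at f p s)"
  by (simp add: breakpoints_def)

lemma breakpoints_inv:
  assumes "bij f"
  shows "breakpoints (inverse_map f) \<subseteq> f ` breakpoints f"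
proof
  fix q assume q: "q \<in> breakpoints (inverse_map f)"
  have "f (inverse_map f q) = q"
    using assms by (simp add: bij_is_surj surj_f_inv_f)
  moreover from this have "inverse_map f q \<in> breakpoints f"
    using affine_at_inv[of f "inverse_map f q"] assms q by (auto simp: breakpoints_def bij_is_inj)
  ultimately show "q \<in> f ` breakpoints f"
    by (metis image_eqI)
qed

section \<open>The cyclic order\<close>

lemma cyclically_ordered_distinct:
  assumes "cyclically_ordered p q r"
  shows "p \<noteq> q" "p \<noteq> r" "q \<noteq> r"
proof -
  obtain x y z where *: "p = circ x" "q = circ y" "r = circ z" "x < y" "y < z" "z < x + 1"
    using assms by (auto simp: cyclically_ordered_def)
  show "p \<noteq> q" using circ_eq_imp_eq[of x y] * by auto
  show "p \<noteq> r" using circ_eq_imp_eq[of x z] * by auto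
  show "q \<noteq> r" using circ_eq_imp_eq[of y z] * by auto
qed

lemma representative_after:
  assumes "q \<noteq> circ x"
  obtains y where "q = circ y" "x < y" "y < x + 1"
proof -
  obtain t where t: "q = circ t"
    by (rule circle_cases)
  define y where "y = x + frac (t - x)"
  have "q = circ y"
    unfolding t y_def frac_def circ_eq_iff by simp
  moreover from this have "frac (t - x) \<noteq> 0"
    using assms unfolding y_def by (metis add.right_neutral)
  then have "x < y" "y < x + 1"
    using frac_ge_0[of "t - x"] frac_lt_1[of "t - x"] by (auto simp: y_def)
  ultimately show thesis
    by (rule that)
qed

lemma cyclically_ordered_total:
  assumes "p \<noteq> q" "p \<noteq> r" "q \<noteq> r"
  shows "cyclically_ordered p q r \<or> cyclically_ordered p r q"
proof -
  obtain x where x: "p = circ x"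
    by (rule circle_cases)
  obtain y where y: "q = circ y" "x < y" "y < x + 1"
    using assms x by (metis representative_after)
  obtain z where z: "r = circ z" "x < z" "z < x + 1"
    using assms x by (metis representative_after)
  have "y \<noteq> z"
    using assms y z by auto
  then show ?thesis
    using x y z unfolding cyclically_ordered_def by (metis linorder_neqE_linordered_idom)
qed

lemma cyclically_ordered_asym:
  assumes "cyclically_ordered p q r"
  shows "\<not> cyclically_ordered p r q"
proof
  assume "cyclically_ordered p r q"
  then obtain x' y' z' where 1: "p = circ x'" "r = circ z'" "q = circ y'" "x' < z'" "z' < y'" "y' < x' + 1"
    by (auto simp: cyclically_ordered_def)
  obtain x y z where 2: "p = circ x" "q = circ y" "r = circ z" "x < y" "y < z" "z < x + 1"
    using assms by (auto simp: cyclically_ordered_def)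
  obtain k where k: "x' = x + of_int k"
    using 1 2 by (metis circ_eq_iff Ints_cases add.commute diff_add_cancel)
  have "y' - of_int k = y"
    by (rule circ_eq_imp_eq) (use 1 2 k in auto)
  moreover have "z' - of_int k = z"
    by (rule circ_eq_imp_eq) (use 1 2 k in auto)
  ultimately show False
    using 1 2 by linarith
qed

text \<open>Of the two cyclic orders of three distinct points exactly one holds, so a map that preserves the
  order also reflects it.\<close>

lemma cyclically_ordered_inv:
  assumes f: "\<And>p q r. cyclically_ordered p q r \<Longrightarrow> cyclically_ordered (f p) (f q) (f r)"
    and "bij f" and pqr: "cyclically_ordered p q r"
  shows "cyclically_ordered (inverse_map f p) (inverse_map f q) (inverse_map f r)"
proof (rule ccontr)
  assume "\<not> cyclically_ordered (inverse_map f p) (inverse_map f q) (inverse_map f r)"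
  moreover have "inj (inverse_map f)"
    using \<open>bij f\<close> by (simp add: bij_imp_bij_inv bij_is_inj)
  ultimately have "cyclically_ordered (inverse_map f p) (inverse_map f r) (inverse_map f q)"
    using cyclically_ordered_total cyclically_ordered_distinct[OF pqr] by (metis injD)
  then have "cyclically_ordered (f (inverse_map f p)) (f (inverse_map f r)) (f (inverse_map f q))"
    by (rule f)
  then show False
    using cyclically_ordered_asym[OF pqr] \<open>bij f\<close> by (simp add: bij_is_surj surj_f_inv_f)
qed

section \<open>The group structure of \<open>T\<close>\<close>

lemma thompson_T_simps [simp]:
  "f \<otimes>\<^bsub>thompson_T\<^esub> g = f \<circ> g" "\<one>\<^bsub>thompson_T\<^esub> = id"
  by (simp_all add: thompson_T_def)

lemma thompson_T_D:
  assumes "f \<in> carrier thompson_T"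
  shows "homeomorphism UNIV UNIV f (inverse_map f)" "bij f"
    "\<And>p q r. cyclically_ordered p q r \<Longrightarrow> cyclically_ordered (f p) (f q) (f r)"
    "finite (breakpoints f)" "breakpoints f \<subseteq> dyadic_points"
    "\<And>p s. affine_at f p s \<Longrightarrow> \<exists>n :: int. s = 2 powi n"
    "f ` dyadic_points = dyadic_points"
proof -
  show *: "homeomorphism UNIV UNIV f (inverse_map f)"
    using assms by (simp add: thompson_T_def)
  show "bij f"
    by (rule o_bij[of "inverse_map f"]) (use * in \<open>auto simp: homeomorphism_def fun_eq_iff\<close>)
qed (use assms in \<open>auto simp: thompson_T_def\<close>)

text \<open>Only \<open>f\<close> itself needs to be examined: \<open>f\<close> maps its breakpoints onto those
  of its inverse and permutes the dyadic points.\<close>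

lemma thompson_T_I:
  assumes h: "homeomorphism UNIV UNIV f (inverse_map f)"
    and cyc: "\<And>p q r. cyclically_ordered p q r \<Longrightarrow> cyclically_ordered (f p) (f q) (f r)"
    and S: "finite S" "S \<subseteq> dyadic_points"
    and slopes: "\<And>p. p \<notin> S \<Longrightarrow> \<exists>n :: int. affine_at f p (2 powi n)"
    and dyadic: "f ` dyadic_points = dyadic_points"
  shows "f \<in> carrier thompson_T"
proof -
  have "bij f"
    by (rule o_bij[of "inverse_map f"]) (use h in \<open>auto simp: homeomorphism_def fun_eq_iff\<close>)
  have "breakpoints f \<subseteq> S"
    using slopes breakpoints_iff by blast
  moreover from this have "breakpoints (inverse_map f) \<subseteq> f ` S"
    using breakpoints_inv[OF \<open>bij f\<close>] by blast
  moreover have "f ` S \<subseteq> dyadic_points"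
    using S(2) dyadic by blast
  ultimately have "finite (breakpoints f)" "finite (breakpoints (inverse_map f))"
    "breakpoints f \<subseteq> dyadic_points" "breakpoints (inverse_map f) \<subseteq> dyadic_points"
    using S finite_subset by (blast intro: finite_imageI)+
  moreover have "\<forall>p s. affine_at f p s \<longrightarrow> (\<exists>n :: int. s = 2 powi n)"
    using slope_powi[OF S(1) slopes] by blast
  ultimately show ?thesis
    using h cyc dyadic unfolding thompson_T_def by simp
qed

lemma thompson_T_slope:
  assumes "f \<in> carrier thompson_T" "p \<notin> breakpoints f"
  shows "\<exists>n :: int. affine_at f p (2 powi n)"
proof -
  obtain s where s: "affine_at f p s"
    using assms(2) by (auto simp: breakpoints_def)
  then obtain n :: int where "s = 2 powi n"
    using thompson_T_D(6)[OF assms(1)] by blast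
  then show ?thesis
    using s by blast
qed

lemma thompson_T_compose:
  assumes f: "f \<in> carrier thompson_T" and g: "g \<in> carrier thompson_T"
  shows "f \<circ> g \<in> carrier thompson_T"
proof (rule thompson_T_I)
  note F = thompson_T_D[OF f] and G = thompson_T_D[OF g]
  have "homeomorphism UNIV UNIV (f \<circ> g) (inverse_map g \<circ> inverse_map f)"
    by (rule homeomorphism_compose[OF G(1) F(1)])
  then show "homeomorphism UNIV UNIV (f \<circ> g) (inverse_map (f \<circ> g))"
    by (simp add: o_inv_distrib F(2) G(2))
  show "cyclically_ordered ((f \<circ> g) p) ((f \<circ> g) q) ((f \<circ> g) r)" if "cyclically_ordered p q r" for p q r
    using F(3)[OF G(3)[OF that]] by simp
  show "finite (breakpoints g \<union> g -` breakpoints f)"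
    using F(4) G(2,4) by (simp add: finite_vimageI bij_is_inj)
  have "p \<in> dyadic_points" if "g p \<in> dyadic_points" for p
    using that inj_image_mem_iff[OF bij_is_inj[OF G(2)], of p dyadic_points] G(7) by simp
  then show "breakpoints g \<union> g -` breakpoints f \<subseteq> dyadic_points"
    using F(5) G(5) by auto
  show "\<exists>n :: int. affine_at (f \<circ> g) p (2 powi n)" if p: "p \<notin> breakpoints g \<union> g -` breakpoints f" for p
  proof -
    obtain m :: int where m: "affine_at g p (2 powi m)"
      using thompson_T_slope[OF g, of p] p by auto
    obtain n :: int where n: "affine_at f (g p) (2 powi n)"
      using thompson_T_slope[OF f, of "g p"] p by auto
    have "affine_at (f \<circ> g) p (2 powi (n + m))"
      using affine_at_compose[OF m n] by (simp add: power_int_add)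
    then show ?thesis ..
  qed
  show "(f \<circ> g) ` dyadic_points = dyadic_points"
    using F(7) G(7) by (metis image_comp)
qed

lemma thompson_T_inv:
  assumes f: "f \<in> carrier thompson_T"
  shows "inverse_map f \<in> carrier thompson_T"
proof (rule thompson_T_I)
  note F = thompson_T_D[OF f]
  show "homeomorphism UNIV UNIV (inverse_map f) (inverse_map (inverse_map f))"
    using homeomorphism_symD[OF F(1)] F(2) by (simp add: inv_inv_eq)
  show "cyclically_ordered (inverse_map f p) (inverse_map f q) (inverse_map f r)" if "cyclically_ordered p q r" for p q r
    by (rule cyclically_ordered_inv[OF F(3,2) that])
  show "finite (f ` breakpoints f)" "f ` breakpoints f \<subseteq> dyadic_points"
    using F(4,5,7) by auto
  show "\<exists>n :: int. affine_at (inverse_map f) p (2 powi n)" if p: "p \<notin> f ` breakpoints f" for p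
  proof -
    have fp: "f (inverse_map f p) = p"
      using F(2) by (simp add: bij_is_surj surj_f_inv_f)
    then have "inverse_map f p \<notin> breakpoints f"
      using p image_eqI[of p f "inverse_map f p"] by auto
    then obtain n :: int where "affine_at f (inverse_map f p) (2 powi n)"
      using thompson_T_slope[OF f, of "inverse_map f p"] by blast
    then have "affine_at (inverse_map f) p (2 powi (- n))"
      using affine_at_inv[of f "inverse_map f p"] F(2) fp by (simp add: bij_is_inj power_int_minus inverse_eq_divide)
    then show ?thesis ..
  qed
  show "inverse_map f ` dyadic_points = dyadic_points"
    using image_inv_f_f[OF bij_is_inj[OF F(2)], of dyadic_points] F(7) by simp
qed

lemma thompson_T_id: "id \<in> carrier thompson_T"
proof (rule thompson_T_I[where S = "{}"])
  show "homeomorphism UNIV UNIV id (inverse_map id)"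
    by (simp add: homeomorphism_def)
  have "affine_at id p (2 powi 0)" for p
  proof -
    obtain x where "p = circ x" by (rule circle_cases)
    then show ?thesis
      using affine_at_interval[of "x - 1" "x + 1" id 0 1 x] by simp
  qed
  then show "\<exists>n :: int. affine_at id p (2 powi n)" for p
    by blast
qed auto

lemma group_thompson_T: "group thompson_T"
proof (rule groupI)
  fix f assume f: "f \<in> carrier thompson_T"
  have "inverse_map f \<circ> f = id"
    using thompson_T_D(2)[OF f] by (simp add: bij_is_inj)
  then show "\<exists>g\<in>carrier thompson_T. g \<otimes>\<^bsub>thompson_T\<^esub> f = \<one>\<^bsub>thompson_T\<^esub>"
    using thompson_T_inv[OF f] by auto
qed (auto simp: thompson_T_compose thompson_T_id comp_assoc)

section \<open>The elements \<open>C\<close> and \<open>D\<close>\<close>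

lemma continuous_on_lift:
  assumes lift: "\<And>t. f (circ t) = circ (F t)" and F: "strict_mono F" "surj F"
  shows "continuous_on UNIV f"
proof -
  have "continuous_on UNIV F"
    by (rule continuous_onI_mono) (use F in \<open>auto simp: strict_mono_less_eq\<close>)
  then have "open (circ -` f -` U)" if "open U" for U
    using that open_vimage[of "circ -` U" F] lift
    by (simp add: open_circle_def vimage_def)
  then show ?thesis
    by (simp add: continuous_on_open_vimage open_circle_def)
qed

text \<open>For a circle map with an increasing lift that commutes with the unit translation, the inverse of the
  lift is a lift of the inverse. Increasing surjections of the line are continuous.\<close>

lemma
  fixes F :: "real \<Rightarrow> real"
  assumes lift: "\<And>t. f (circ t) = circ (F t)"
    and F: "strict_mono F" "surj F" "\<And>t. F (t + 1) = F t + 1"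
  shows homeomorphism_lift: "homeomorphism UNIV UNIV f (inverse_map f)"
    and cyclically_ordered_lift: "cyclically_ordered p q r \<Longrightarrow> cyclically_ordered (f p) (f q) (f r)"
proof -
  have shift_nat: "F (t + of_nat n) = F t + of_nat n" for t n
  proof (induction n)
    case (Suc n)
    then show ?case
      using F(3)[of "t + of_nat n"] by (simp add: add_ac)
  qed simp
  have shift: "F (t + of_int k) = F t + of_int k" for t k
  proof (cases k)
    case (neg n)
    then show ?thesis
      using shift_nat[of "t + of_int k" "Suc n"] by simp
  qed (simp add: shift_nat)
  have inj: "inj f"
  proof (rule injI)
    fix p q assume eq: "f p = f q"
    obtain x y where xy: "p = circ x" "q = circ y"
      by (metis circle_cases)
    then obtain k where "F x = F y + of_int k"
      using eq lift by (metis circ_eq_iff Ints_cases add.commute diff_add_cancel)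
    then have "x = y + of_int k"
      using F(1) shift by (metis strict_mono_eq)
    then show "p = q"
      using xy by simp
  qed
  have surj: "surj f"
    using F(2) lift by (metis circle_cases surj_def)
  have F_inv: "F (inverse_map F t) = t" for t
    using F(2) by (simp add: surj_f_inv_f)
  have "inverse_map f (circ t) = circ (inverse_map F t)" for t
    by (rule inv_f_eq[OF inj]) (simp add: lift F_inv)
  moreover have "strict_mono (inverse_map F)"
    by (rule strict_monoI) (use F(1) F_inv in \<open>metis strict_mono_less\<close>)
  moreover have "surj (inverse_map F)"
    using F(1) by (metis inj_imp_surj_inv strict_mono_imp_inj_on)
  ultimately have "continuous_on UNIV (inverse_map f)"
    by (rule continuous_on_lift)
  moreover have "continuous_on UNIV f"
    by (rule continuous_on_lift[OF lift F(1,2)])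
  ultimately show "homeomorphism UNIV UNIV f (inverse_map f)"
    using inj surj by (simp add: homeomorphism_def surj_f_inv_f inj_imp_surj_inv)
  show "cyclically_ordered (f p) (f q) (f r)" if pqr: "cyclically_ordered p q r"
  proof -
    obtain x y z where *: "p = circ x" "q = circ y" "r = circ z" "x < y" "y < z" "z < x + 1"
      using pqr by (auto simp: cyclically_ordered_def)
    then have "F x < F y" "F y < F z" "F z < F x + 1"
      using F(1) F(3)[of x] by (metis strict_mono_less)+
    then show ?thesis
      using * lift unfolding cyclically_ordered_def by metis
  qed
qed

lemma circ_in_dyadic_points: "circ x \<in> dyadic_points \<longleftrightarrow> (\<exists>(k :: int) n. x = of_int k / 2 ^ n)"
proof
  assume "circ x \<in> dyadic_points"
  then obtain k :: int and n where "circ x = circ (of_int k / 2 ^ n)"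
    by (auto simp: dyadic_points_def)
  then obtain m where "x - of_int k / 2 ^ n = of_int m"
    by (auto simp: circ_eq_iff elim: Ints_cases)
  then have "x = of_int (k + m * 2 ^ n) / 2 ^ n"
    by (simp add: field_simps)
  then show "\<exists>(k :: int) n. x = of_int k / 2 ^ n"
    by blast
qed (auto simp: dyadic_points_def)

lemma dyadic_affine:
  assumes "circ x \<in> dyadic_points"
  shows "circ ((of_int a * x + of_int b) / 4) \<in> dyadic_points"
proof -
  obtain k :: int and n where "x = of_int k / 2 ^ n"
    using assms circ_in_dyadic_points by blast
  then have "(of_int a * x + of_int b) / 4 = of_int (a * k + b * 2 ^ n) / 2 ^ (n + 2)"
    by (simp add: field_simps)
  then show ?thesis
    using circ_in_dyadic_points by blast
qed

lemma circ_minus_one: "circ (x - 1) = circ x"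
  using circ_plus_int[of x "-1"] by simp

lemma thompson_D_order: "thompson_D (thompson_D (thompson_D (thompson_D p))) = p"
proof -
  obtain t where "p = circ t" by (rule circle_cases)
  then show ?thesis
    by (simp add: thompson_D_circ circ_minus_one)
qed

lemma thompson_C_order: "thompson_C (thompson_C (thompson_C p)) = p"
proof -
  have C1: "thompson_C (circ t) = circ u" if "u = t / 2 + 3/4" "0 \<le> t" "t \<le> 1/2" for t u
    using that thompson_C_circ(1) by simp
  have C2: "thompson_C (circ t) = circ u" if "u = 2 * t - 1" "1/2 \<le> t" "t \<le> 3/4" for t u
    using that thompson_C_circ(2) by simp
  have C3: "thompson_C (circ t) = circ u" if "u = t - 1/4" "3/4 \<le> t" "t \<le> 1" for t u
    using that thompson_C_circ(3) by simp
  obtain t where t: "0 \<le> t" "t < 1" "p = circ t" by (rule circle_cases)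
  consider "t \<le> 1/2" | "1/2 \<le> t" "t \<le> 3/4" | "3/4 \<le> t"
    by linarith
  then show ?thesis
  proof cases
    case 1
    then show ?thesis
      using t C1[of "t / 2 + 3/4" t] C3[of "t / 2 + 1/2" "t / 2 + 3/4"] C2[of t "t / 2 + 1/2"] by simp
  next
    case 2
    then show ?thesis
      using t C2[of "2 * t - 1" t] C1[of "t + 1/4" "2 * t - 1"] C3[of t "t + 1/4"]
      by (simp add: field_simps)
  next
    case 3
    then show ?thesis
      using t C3[of "t - 1/4" t] C2[of "2 * t - 3/2" "t - 1/4"] C1[of t "2 * t - 3/2"]
      by (simp add: field_simps)
  qed
qed

lemma thompson_CD_circ:
  "0 \<le> t \<Longrightarrow> t \<le> 1/4 \<Longrightarrow> thompson_C (thompson_D (circ t)) = circ (t + 1/2)"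
  "1/4 \<le> t \<Longrightarrow> t \<le> 3/4 \<Longrightarrow> thompson_C (thompson_D (circ t)) = circ (t / 2 + 5/8)"
  "3/4 \<le> t \<Longrightarrow> t \<le> 1 \<Longrightarrow> thompson_C (thompson_D (circ t)) = circ (2 * t - 3/2)"
proof -
  assume "0 \<le> t" "t \<le> 1/4"
  moreover have "circ (t - 1/4) = circ (t + 3/4)"
    using circ_minus_one[of "t + 3/4"] by simp
  ultimately show "thompson_C (thompson_D (circ t)) = circ (t + 1/2)"
    using thompson_C_circ(3)[of "t + 3/4"] by (simp add: thompson_D_circ add.commute)
qed (simp_all add: thompson_D_circ thompson_C_circ diff_divide_distrib right_diff_distrib add.commute)

text \<open>The map \<open>C \<circ> D\<close> permutes the five arcs between the points
  \<open>0, 1/4, 1/2, 3/4, 7/8\<close> cyclically, by affine maps. After five steps each arc is back, with an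
  increasing affine map of the arc onto itself.\<close>

lemma pentagon_relation:
  "((thompson_C \<circ> thompson_D) ^^ 5) p = p"
proof -
  obtain t where t: "0 \<le> t" "t < 1" "p = circ t" by (rule circle_cases)
  consider "t \<le> 1/4" | "1/4 \<le> t" "t \<le> 1/2" | "1/2 \<le> t" "t \<le> 3/4"
    | "3/4 \<le> t" "t \<le> 7/8" | "7/8 \<le> t"
    by linarith
  then show ?thesis
    using t by cases (simp_all add: thompson_CD_circ eval_nat_numeral field_simps)
qed

lemma thompson_C_eq_D: "3/4 \<le> t \<Longrightarrow> t \<le> 1 \<Longrightarrow> thompson_C (circ t) = thompson_D (circ t)"
  by (simp add: thompson_C_circ thompson_D_circ)

lemma thompson_D_in_T: "thompson_D \<in> carrier thompson_T"
proof (rule thompson_T_I[where S = "{}"])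
  have lift: "thompson_D (circ t) = circ ((\<lambda>t. t - 1/4) t)" for t
    by (simp add: thompson_D_circ)
  have F: "strict_mono (\<lambda>t :: real. t - 1/4)" "surj (\<lambda>t :: real. t - 1/4)"
    by (auto simp: strict_mono_def intro: surjI[where f = "\<lambda>t. t + 1/4"])
  show "homeomorphism UNIV UNIV thompson_D (inverse_map thompson_D)"
    by (rule homeomorphism_lift[OF lift F]) simp
  show "cyclically_ordered (thompson_D p) (thompson_D q) (thompson_D r)"
    if "cyclically_ordered p q r" for p q r
    by (rule cyclically_ordered_lift[OF lift F _ that]) simp
  have "affine_at thompson_D p (2 powi 0)" for p
  proof -
    obtain x where "p = circ x" by (rule circle_cases)
    then show ?thesis
      using affine_at_interval[of "x - 1" "x + 1" thompson_D "- 1/4" 1 x]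
      by (simp add: thompson_D_circ)
  qed
  then show "\<exists>n :: int. affine_at thompson_D p (2 powi n)" for p
    by blast
  have *: "thompson_D p \<in> dyadic_points" if "p \<in> dyadic_points" for p
  proof -
    obtain x where "p = circ x" by (rule circle_cases)
    then show ?thesis
      using dyadic_affine[of x 4 "-1"] that by (simp add: thompson_D_circ diff_divide_distrib)
  qed
  show "thompson_D ` dyadic_points = dyadic_points"
  proof (intro equalityI image_subsetI subsetI *)
    fix p assume "p \<in> dyadic_points"
    then have "thompson_D (thompson_D (thompson_D p)) \<in> dyadic_points"
      by (intro *)
    then show "p \<in> thompson_D ` dyadic_points"
      by (rule image_eqI[rotated]) (simp add: thompson_D_order)
  qed
qed auto

text \<open>On \<open>[0, 1)\<close> the lift takes the values \<open>t / 2 + 3/4\<close>, \<open>2 * t\<close>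
  and \<open>t + 3/4\<close>: the formulas for \<open>C\<close> on its three arcs, increased by \<open>1\<close>
  on the last two. It maps \<open>[0, 1)\<close> onto \<open>[3/4, 7/4)\<close>.\<close>

lemma thompson_C_lift:
  obtains F where "\<And>t. thompson_C (circ t) = circ (F t)" "strict_mono F" "surj F"
    "\<And>t :: real. F (t + 1) = F t + 1"
proof
  define c :: "real \<Rightarrow> real" where
    "c r = (if r \<le> 1/2 then r / 2 + 3/4 else if r \<le> 3/4 then 2 * r else r + 3/4)" for r
  define F where "F t = of_int \<lfloor>t\<rfloor> + c (frac t)" for t
  have c: "3/4 \<le> c (frac t)" "c (frac t) < 7/4" for t
    using frac_ge_0[of t] frac_lt_1[of t] by (auto simp: c_def)
  show "thompson_C (circ t) = circ (F t)" for t
  proof -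
    have "circ t = circ (frac t)"
      by (simp add: circ_eq_iff frac_def)
    moreover have "circ (F t) = circ (c (frac t))"
      by (simp add: F_def circ_eq_iff)
    moreover have "thompson_C (circ (frac t)) = circ (c (frac t))"
      using frac_ge_0[of t] frac_lt_1[of t] circ_minus_one[of "2 * frac t"]
        circ_minus_one[of "frac t + 3/4"]
      by (auto simp: c_def thompson_C_circ)
    ultimately show ?thesis
      by simp
  qed
  show "strict_mono F"
  proof (rule strict_monoI)
    fix x y :: real assume xy: "x < y"
    show "F x < F y"
    proof (cases "\<lfloor>x\<rfloor> = \<lfloor>y\<rfloor>")
      case True
      then have "frac x < frac y"
        using xy by (simp add: frac_def)
      then show ?thesis
        using True by (auto simp: F_def c_def)
    next
      case False
      then have "\<lfloor>x\<rfloor> + 1 \<le> \<lfloor>y\<rfloor>"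
        using floor_mono[of x y] xy by simp
      then have "of_int \<lfloor>x\<rfloor> + 1 \<le> (of_int \<lfloor>y\<rfloor> :: real)"
        by linarith
      then show ?thesis
        using c[of x] c[of y] by (simp add: F_def)
    qed
  qed
  show "F (t + 1) = F t + 1" for t
    by (simp add: F_def frac_def)
  show "surj F"
    unfolding surj_def
  proof
    fix y :: real
    define n where "n = \<lfloor>y - 3/4\<rfloor>"
    define u where "u = y - of_int n"
    have u: "3/4 \<le> u" "u < 7/4"
      unfolding u_def n_def by linarith+
    define r where "r = (if u \<le> 1 then 2 * u - 3/2 else if u \<le> 3/2 then u / 2 else u - 3/4)"
    have r: "0 \<le> r" "r < 1" "c r = u"
      using u by (auto simp: r_def c_def) (simp add: field_simps)
    have "\<lfloor>of_int n + r\<rfloor> = n"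
      using r by (simp add: floor_eq_iff)
    then have "F (of_int n + r) = of_int n + c r"
      by (simp add: F_def frac_def)
    then have "y = F (of_int n + r)"
      using r(3) by (simp add: u_def)
    then show "\<exists>x. y = F x" ..
  qed
qed

lemma thompson_C_in_T: "thompson_C \<in> carrier thompson_T"
proof (rule thompson_T_I[where S = "{circ 0, circ (1/2), circ (3/4)}"])
  obtain F where F: "\<And>t. thompson_C (circ t) = circ (F t)" "strict_mono F" "surj F"
    "\<And>t :: real. F (t + 1) = F t + 1"
    by (fact thompson_C_lift)
  show "homeomorphism UNIV UNIV thompson_C (inverse_map thompson_C)"
    by (rule homeomorphism_lift[OF F])
  show "cyclically_ordered (thompson_C p) (thompson_C q) (thompson_C r)"
    if "cyclically_ordered p q r" for p q r
    by (rule cyclically_ordered_lift[OF F that])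
  have zero: "circ 0 \<in> dyadic_points"
    unfolding circ_in_dyadic_points by (intro exI[of _ 0]) simp
  show "{circ 0, circ (1/2), circ (3/4)} \<subseteq> dyadic_points"
    using zero dyadic_affine[OF zero, of 0 2] dyadic_affine[OF zero, of 0 3] by simp
  show "\<exists>n :: int. affine_at thompson_C p (2 powi n)"
    if p: "p \<notin> {circ 0, circ (1/2), circ (3/4)}" for p
  proof -
    obtain t where t: "0 \<le> t" "t < 1" "p = circ t" by (rule circle_cases)
    then have "t \<noteq> 0" "t \<noteq> 1/2" "t \<noteq> 3/4"
      using p by blast+
    then consider "0 < t" "t < 1/2" | "1/2 < t" "t < 3/4" | "3/4 < t"
      using t by linarith
    then show ?thesis
    proof cases
      case 1
      have "affine_at thompson_C p (1/2)"
        unfolding t(3) by (rule affine_at_interval[of 0 "1/2" _ "3/4"])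
          (use 1 in \<open>auto simp: thompson_C_circ add.commute\<close>)
      then show ?thesis
        by (intro exI[of _ "-1"]) (simp add: power_int_minus)
    next
      case 2
      have "affine_at thompson_C p 2"
        unfolding t(3) by (rule affine_at_interval[of "1/2" "3/4" _ "-1"])
          (use 2 in \<open>auto simp: thompson_C_circ\<close>)
      then show ?thesis
        by (intro exI[of _ 1]) simp
    next
      case 3
      have "affine_at thompson_C p 1"
        unfolding t(3) by (rule affine_at_interval[of "3/4" 1 _ "-1/4"])
          (use 3 t in \<open>auto simp: thompson_C_circ\<close>)
      then show ?thesis
        by (intro exI[of _ 0]) simp
    qed
  qed
  have *: "thompson_C p \<in> dyadic_points" if "p \<in> dyadic_points" for p
  proof -
    obtain t where t: "0 \<le> t" "t < 1" "p = circ t" by (rule circle_cases)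
    consider "t \<le> 1/2" | "1/2 \<le> t" "t \<le> 3/4" | "3/4 \<le> t"
      by linarith
    then show ?thesis
    proof cases
      case 1
      then show ?thesis
        using t that dyadic_affine[of t 2 3] by (simp add: thompson_C_circ add_divide_distrib)
    next
      case 2
      then show ?thesis
        using t that dyadic_affine[of t 8 "-4"] by (simp add: thompson_C_circ diff_divide_distrib)
    next
      case 3
      then show ?thesis
        using t that dyadic_affine[of t 4 "-1"] by (simp add: thompson_C_circ diff_divide_distrib)
    qed
  qed
  show "thompson_C ` dyadic_points = dyadic_points"
  proof (intro equalityI image_subsetI subsetI *)
    fix p assume "p \<in> dyadic_points"
    then have "thompson_C (thompson_C p) \<in> dyadic_points"
      by (intro *)
    then show "p \<in> thompson_C ` dyadic_points"
      by (rule image_eqI[rotated]) (simp add: thompson_C_order)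
  qed
qed auto

section \<open>The finite subgroups generated by \<open>C\<close> and \<open>D\<close>\<close>

definition C_powers :: "(circle \<Rightarrow> circle) set" where
  "C_powers = {id, thompson_C, thompson_C \<circ> thompson_C}"

definition D_powers :: "(circle \<Rightarrow> circle) set" where
  "D_powers = {id, thompson_D, thompson_D \<circ> thompson_D, thompson_D \<circ> thompson_D \<circ> thompson_D}"

lemma C_powers_at_0:
  "thompson_C (circ 0) = circ (3/4)" "thompson_C (circ (3/4)) = circ (1/2)"
  by (simp_all add: thompson_C_circ)

lemma circ_neq: "x \<noteq> y \<Longrightarrow> \<bar>x - y\<bar> < 1 \<Longrightarrow> circ x \<noteq> circ y"
  using circ_eq_imp_eq by blast

lemma C_powers_distinct:
  "thompson_C \<noteq> id" "thompson_C \<circ> thompson_C \<noteq> id" "thompson_C \<circ> thompson_C \<noteq> thompson_C"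
proof -
  have *: "thompson_C (circ 0) = circ (3/4)" "(thompson_C \<circ> thompson_C) (circ 0) = circ (1/2)"
    "id (circ 0) = circ 0"
    by (simp_all add: C_powers_at_0)
  have ne: "circ (3/4) \<noteq> circ 0" "circ (1/2) \<noteq> circ 0" "circ (1/2) \<noteq> circ (3/4)"
    by (rule circ_neq; simp)+
  show "thompson_C \<noteq> id" using *(1,3) ne(1) by metis
  show "thompson_C \<circ> thompson_C \<noteq> id" using *(2,3) ne(2) by metis
  show "thompson_C \<circ> thompson_C \<noteq> thompson_C" using *(1,2) ne(3) by metis
qed

lemma D_powers_distinct:
  "thompson_D \<noteq> id" "thompson_D \<circ> thompson_D \<noteq> id" "thompson_D \<circ> thompson_D \<noteq> thompson_D"
  "thompson_D \<circ> thompson_D \<circ> thompson_D \<noteq> id" "thompson_D \<circ> thompson_D \<circ> thompson_D \<noteq> thompson_D"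
  "thompson_D \<circ> thompson_D \<circ> thompson_D \<noteq> thompson_D \<circ> thompson_D"
proof -
  have *: "thompson_D (circ 0) = circ (-1/4)" "(thompson_D \<circ> thompson_D) (circ 0) = circ (-1/2)"
    "(thompson_D \<circ> thompson_D \<circ> thompson_D) (circ 0) = circ (-3/4)" "id (circ 0) = circ 0"
    by (simp_all add: thompson_D_circ)
  have ne: "circ (-1/4) \<noteq> circ 0" "circ (-1/2) \<noteq> circ 0" "circ (-3/4) \<noteq> circ 0"
    "circ (-1/2) \<noteq> circ (-1/4)" "circ (-3/4) \<noteq> circ (-1/4)" "circ (-3/4) \<noteq> circ (-1/2)"
    by (rule circ_neq; simp)+
  show "thompson_D \<noteq> id" using *(1,4) ne(1) by metis
  show "thompson_D \<circ> thompson_D \<noteq> id" using *(2,4) ne(2) by metis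
  show "thompson_D \<circ> thompson_D \<noteq> thompson_D" using *(1,2) ne(4) by metis
  show "thompson_D \<circ> thompson_D \<circ> thompson_D \<noteq> id" using *(3,4) ne(3) by metis
  show "thompson_D \<circ> thompson_D \<circ> thompson_D \<noteq> thompson_D" using *(1,3) ne(5) by metis
  show "thompson_D \<circ> thompson_D \<circ> thompson_D \<noteq> thompson_D \<circ> thompson_D" using *(2,3) ne(6) by metis
qed

lemma C_cube: "thompson_C \<circ> (thompson_C \<circ> thompson_C) = id"
  by (simp add: fun_eq_iff thompson_C_order)

lemma D_fourth: "thompson_D \<circ> (thompson_D \<circ> (thompson_D \<circ> thompson_D)) = id"
  by (simp add: fun_eq_iff thompson_D_order)

lemma subgroup_of_closed:
  assumes "S \<subseteq> carrier thompson_T" "id \<in> S"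
    and "\<And>f g. f \<in> S \<Longrightarrow> g \<in> S \<Longrightarrow> f \<circ> g \<in> S"
    and "\<And>f. f \<in> S \<Longrightarrow> \<exists>g\<in>S. g \<circ> f = id"
  shows "subgroup S thompson_T"
proof -
  interpret group thompson_T
    by (rule group_thompson_T)
  show ?thesis
  proof (rule subgroupI)
    fix f assume f: "f \<in> S"
    then obtain g where "g \<in> S" "g \<circ> f = id"
      using assms(4) by blast
    then show "inv\<^bsub>thompson_T\<^esub> f \<in> S"
      using inv_equality[of g f] f assms(1) by auto
  qed (use assms in auto)
qed

lemma subgroup_C_powers: "subgroup C_powers thompson_T"
proof (rule subgroup_of_closed)
  show "C_powers \<subseteq> carrier thompson_T"
    by (auto simp: C_powers_def thompson_C_in_T thompson_T_id thompson_T_compose)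
  show "f \<circ> g \<in> C_powers" if "f \<in> C_powers" "g \<in> C_powers" for f g
    using that by (auto simp: C_powers_def comp_assoc C_cube)
  show "\<exists>g\<in>C_powers. g \<circ> f = id" if "f \<in> C_powers" for f
    using that by (auto simp: C_powers_def comp_assoc C_cube)
qed (simp add: C_powers_def)

lemma subgroup_D_powers: "subgroup D_powers thompson_T"
proof (rule subgroup_of_closed)
  show "D_powers \<subseteq> carrier thompson_T"
    by (auto simp: D_powers_def thompson_D_in_T thompson_T_id thompson_T_compose)
  have *: "thompson_D \<circ> (thompson_D \<circ> (thompson_D \<circ> (thompson_D \<circ> f))) = f" for f :: "circle \<Rightarrow> circle"
    by (simp add: fun_eq_iff thompson_D_order)
  show "f \<circ> g \<in> D_powers" if "f \<in> D_powers" "g \<in> D_powers" for f g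
    using that by (auto simp: D_powers_def comp_assoc D_fourth *)
  show "\<exists>g\<in>D_powers. g \<circ> f = id" if "f \<in> D_powers" for f
    using that by (auto simp: D_powers_def comp_assoc D_fourth)
qed (simp add: D_powers_def)

interpretation T: finite_subgroup_pair thompson_T C_powers D_powers
proof -
  have "finite_subgroup thompson_T C_powers"
    by (intro finite_subgroup.intro finite_subgroup_axioms.intro group_thompson_T subgroup_C_powers)
       (simp add: C_powers_def)
  moreover have "finite_subgroup thompson_T D_powers"
    by (intro finite_subgroup.intro finite_subgroup_axioms.intro group_thompson_T subgroup_D_powers)
       (simp add: D_powers_def)
  ultimately show "finite_subgroup_pair thompson_T C_powers D_powers"
    by (rule finite_subgroup_pair.intro)
qed

lemma orbit_sum_C:
  fixes R :: "(circle \<Rightarrow> circle) \<Rightarrow> real"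
  shows "orbit_sum thompson_T C_powers R x = R x + R (thompson_C \<circ> x) + R (thompson_C \<circ> (thompson_C \<circ> x))"
  using C_powers_distinct by (simp add: orbit_sum_def C_powers_def comp_assoc)

lemma orbit_sum_D:
  fixes R :: "(circle \<Rightarrow> circle) \<Rightarrow> real"
  shows "orbit_sum thompson_T D_powers R x
    = R x + R (thompson_D \<circ> x) + R (thompson_D \<circ> (thompson_D \<circ> x))
        + R (thompson_D \<circ> (thompson_D \<circ> (thompson_D \<circ> x)))"
  using D_powers_distinct by (simp add: orbit_sum_def D_powers_def comp_assoc)

lemma card_C_powers: "card C_powers = 3"
  using C_powers_distinct by (simp add: C_powers_def)

lemma card_D_powers: "card D_powers = 4"
  using D_powers_distinct by (simp add: D_powers_def)

lemma group_elt_mult: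
  "group_elt g \<otimes>\<^bsub>group_ring thompson_T\<^esub> group_elt h = group_elt (g \<circ> h)"
proof
  fix x
  have "(\<Sum>(u, v) | group_elt g u \<noteq> 0 \<and> group_elt h v \<noteq> 0 \<and> u \<circ> v = x. group_elt g u * group_elt h v)
      = (\<Sum>(u, v)\<in>(if g \<circ> h = x then {(g, h)} else {}). 1)"
    by (rule sum.cong) (auto simp: group_elt_def split: if_splits)
  then show "(group_elt g \<otimes>\<^bsub>group_ring thompson_T\<^esub> group_elt h) x = group_elt (g \<circ> h) x"
    by (auto simp: group_ring_def group_elt_def)
qed

lemma group_ring_one: "\<one>\<^bsub>group_ring thompson_T\<^esub> = group_elt id"
  by (simp add: group_ring_def group_elt_def)

lemma group_ring_add: "a \<oplus>\<^bsub>group_ring G\<^esub> b = (\<lambda>x. a x + b x)"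
  by (simp add: group_ring_def)

lemma set_elt_C_powers:
  "group_elt id \<oplus>\<^bsub>group_ring thompson_T\<^esub> group_elt thompson_C
     \<oplus>\<^bsub>group_ring thompson_T\<^esub> group_elt thompson_C [^]\<^bsub>group_ring thompson_T\<^esub> (2::nat)
   = set_elt C_powers"
  using C_powers_distinct
  by (simp add: nat_pow_def numeral_2_eq_2 group_ring_one group_elt_mult group_ring_add)
     (auto simp: fun_eq_iff[of "\<lambda>x. group_elt _ x + _ x"] group_elt_def set_elt_def C_powers_def)

lemma set_elt_D_powers:
  "group_elt id \<oplus>\<^bsub>group_ring thompson_T\<^esub> group_elt thompson_D
     \<oplus>\<^bsub>group_ring thompson_T\<^esub> group_elt thompson_D [^]\<^bsub>group_ring thompson_T\<^esub> (2::nat)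
     \<oplus>\<^bsub>group_ring thompson_T\<^esub> group_elt thompson_D [^]\<^bsub>group_ring thompson_T\<^esub> (3::nat)
   = set_elt D_powers"
  using D_powers_distinct
  by (simp add: nat_pow_def numeral_2_eq_2 numeral_3_eq_3 group_ring_one group_elt_mult group_ring_add)
     (auto simp: fun_eq_iff[of "\<lambda>x. group_elt _ x + _ x"] group_elt_def set_elt_def D_powers_def)

section \<open>The upper bound\<close>

lift_definition lower_half :: "circle \<Rightarrow> bool" is "\<lambda>x. frac x < 1/2"
proof -
  fix x y :: real
  assume "x - y \<in> \<int>"
  then have "frac x = frac y"
    by (metis frac_diff_zero frac_eq_0_iff)
  then show "(frac x < 1/2) = (frac y < 1/2)"
    by simp
qed

lemma lower_half_circ:
  "0 \<le> t \<Longrightarrow> t < 1 \<Longrightarrow> lower_half (circ t) \<longleftrightarrow> t < 1/2"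
  "-1 \<le> t \<Longrightarrow> t < 0 \<Longrightarrow> lower_half (circ t) \<longleftrightarrow> t < -1/2"
proof -
  show *: "lower_half (circ t) \<longleftrightarrow> t < 1/2" if "0 \<le> t" "t < 1" for t
    using that by (simp add: lower_half.abs_eq frac_eq)
  assume "-1 \<le> t" "t < 0"
  moreover have "circ t = circ (t + 1)"
    using circ_plus_int[of t 1] by simp
  ultimately show "lower_half (circ t) \<longleftrightarrow> t < -1/2"
    using *[of "t + 1"] by auto
qed

text \<open>Exactly two points of each orbit of \<open>D\<close> and exactly one point of each orbit of
  \<open>C\<close> lie in \<open>[0, 1/2)\<close>. If \<open>R\<close> is \<open>w\<close> on this half and
  \<open>1\<close> on the other, the two conditions read \<open>2 * w + 2 \<le> \<rho>\<close> and
  \<open>1 / w + 2 \<le> \<rho>\<close>; they coincide for \<open>w = 1 / sqrt 2\<close>.\<close>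

definition half_weight :: "(circle \<Rightarrow> circle) \<Rightarrow> real" where
  "half_weight f = (if lower_half (f (circ 0)) then 1 / sqrt 2 else 1)"

lemma half_weight_edge_weight:
  "edge_weight thompson_T C_powers D_powers (2 + sqrt 2) half_weight"
  unfolding edge_weight_def
proof (intro ballI conjI)
  fix x :: "circle \<Rightarrow> circle"
  obtain t where t: "0 \<le> t" "t < 1" "x (circ 0) = circ t"
    by (rule circle_cases)
  show "0 < half_weight x"
    by (simp add: half_weight_def)
  have two: "2 / sqrt 2 = sqrt 2"
    by (simp add: real_div_sqrt)
  consider "t < 1/4" | "1/4 \<le> t" "t < 1/2" | "1/2 \<le> t" "t < 3/4" | "3/4 \<le> t"
    by linarith
  then show "orbit_sum thompson_T D_powers half_weight x \<le> 2 + sqrt 2"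
    using two t
    by cases (simp_all add: orbit_sum_D half_weight_def thompson_D_circ lower_half_circ)
  consider "t < 1/2" | "1/2 \<le> t" "t < 3/4" | "3/4 \<le> t"
    by linarith
  then show "orbit_sum thompson_T C_powers (\<lambda>y. 1 / half_weight y) x \<le> 2 + sqrt 2"
  proof cases
    case 1
    then have "thompson_C (circ t) = circ (t / 2 + 3/4)"
      "thompson_C (circ (t / 2 + 3/4)) = circ (t / 2 + 1/2)"
      using t thompson_C_circ(1)[of t] thompson_C_circ(3)[of "t / 2 + 3/4"] by (simp_all add: add.commute)
    then show ?thesis
      using 1 t by (simp add: orbit_sum_C half_weight_def lower_half_circ)
  next
    case 2
    then have "thompson_C (circ t) = circ (2 * t - 1)"
      "thompson_C (circ (2 * t - 1)) = circ (t + 1/4)"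
      using t thompson_C_circ(2)[of t] thompson_C_circ(1)[of "2 * t - 1"]
      by (simp_all add: diff_divide_distrib add.commute)
    then show ?thesis
      using 2 t by (simp add: orbit_sum_C half_weight_def lower_half_circ)
  next
    case 3
    then have "thompson_C (circ t) = circ (t - 1/4)"
      "thompson_C (circ (t - 1/4)) = circ (2 * t - 3/2)"
      using t thompson_C_circ(3)[of t] thompson_C_circ(2)[of "t - 1/4"]
      by (simp_all add: right_diff_distrib)
    then show ?thesis
      using 3 t by (simp add: orbit_sum_C half_weight_def lower_half_circ)
  qed
qed

section \<open>The lower bounds\<close>

lemma free_product_bound:
  "sqrt 12 * (sqrt 2 + sqrt 3) < T.prod_norm"
proof -
  have "fold (path_step thompson_T) (replicate 5 (thompson_C, thompson_D)) id
      = (thompson_C \<circ> thompson_D) ^^ 5"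
    by (simp add: eval_nat_numeral comp_assoc)
  also have "\<dots> = id"
    by (simp add: fun_eq_iff pentagon_relation)
  finally have loop: "fold (path_step thompson_T) (replicate 5 (thompson_C, thompson_D)) id = id" .
  have "(thompson_C, thompson_D) \<in> (C_powers - {id}) \<times> (D_powers - {id})"
    using C_powers_distinct(1) D_powers_distinct(1) by (simp add: C_powers_def D_powers_def)
  then have "set (replicate 5 (thompson_C, thompson_D)) \<subseteq> (C_powers - {id}) \<times> (D_powers - {id})"
    by (simp add: set_replicate_conv_if)
  then show ?thesis
    using T.prod_norm_gt_of_relation[of "replicate 5 (thompson_C, thompson_D)"] loop
    by (simp add: card_C_powers card_D_powers del: fold_replicate)
qed

lemma subgroup_F: "subgroup {f \<in> carrier thompson_T. f (circ 0) = circ 0} thompson_T"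
proof (rule subgroup_of_closed)
  fix f assume f: "f \<in> {f \<in> carrier thompson_T. f (circ 0) = circ 0}"
  then have "inj f"
    using thompson_T_D(2) bij_is_inj by blast
  then show "\<exists>g\<in>{f \<in> carrier thompson_T. f (circ 0) = circ 0}. g \<circ> f = id"
    using f inv_f_eq[of f "circ 0" "circ 0"] by (intro bexI[of _ "inverse_map f"]) (auto simp: thompson_T_inv)
qed (auto simp: thompson_T_id thompson_T_compose)

text \<open>Invariance under \<open>F\<close> means that \<open>R x\<close> depends on \<open>x(0)\<close> only.
  Let \<open>x(0) \<in> [3/4, 1]\<close>. Of \<open>D\<^sup>2 x\<close> and \<open>D\<^sup>3 x\<close>, which
  both map \<open>0\<close> into \<open>[0, 1/2]\<close>, let \<open>h\<close> be the one with the smaller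
  weight, and put \<open>y = C h\<close>, so that again \<open>y(0) \<in> [3/4, 1]\<close>. There
  \<open>C\<close> and \<open>D\<close> agree, so \<open>R (C y) = R (D y)\<close>. The conditions at the coset
  of \<open>x\<close> under \<open>D\<close> and at the coset of \<open>h\<close> under \<open>C\<close> become
  \<open>R x + R (D x) + 2 * R h \<le> \<rho>\<close> and
  \<open>1 / R h + 1 / R y + 1 / R (D y) \<le> \<rho>\<close>. Adding them and using
  \<open>2 * u + 1 / u \<ge> 2 * sqrt 2\<close> and \<open>u + 1 / u \<ge> 2\<close> shows that
  \<open>R y + R (D y)\<close> exceeds \<open>R x + R (D x)\<close> by at least
  \<open>4 + 2 * sqrt 2 - 2 * \<rho>\<close>.\<close>

lemma F_invariant_edge_weight_ge:
  assumes R: "edge_weight thompson_T C_powers D_powers \<rho> R"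
    and F: "\<And>x h. x \<in> carrier thompson_T \<Longrightarrow> h \<in> carrier thompson_T \<Longrightarrow> h (circ 0) = circ 0 \<Longrightarrow> R (x \<circ> h) = R x"
  shows "2 + sqrt 2 \<le> \<rho>"
proof (rule ccontr)
  assume "\<not> 2 + sqrt 2 \<le> \<rho>"
  define \<delta> where "\<delta> = 4 + 2 * sqrt 2 - 2 * \<rho>"
  have \<delta>: "0 < \<delta>"
    using \<open>\<not> 2 + sqrt 2 \<le> \<rho>\<close> by (simp add: \<delta>_def)
  note C = thompson_T_compose[OF thompson_C_in_T] and D = thompson_T_compose[OF thompson_D_in_T]
  have pos: "0 < R x" if "x \<in> carrier thompson_T" for x
    using R that by (simp add: edge_weight_def)
  have RC: "1 / R x + 1 / R (thompson_C \<circ> x) + 1 / R (thompson_C \<circ> (thompson_C \<circ> x)) \<le> \<rho>"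
    if "x \<in> carrier thompson_T" for x
    using R that unfolding edge_weight_def orbit_sum_C by blast
  have RD: "R x + R (thompson_D \<circ> x) + R (thompson_D \<circ> (thompson_D \<circ> x))
        + R (thompson_D \<circ> (thompson_D \<circ> (thompson_D \<circ> x))) \<le> \<rho>"
    if "x \<in> carrier thompson_T" for x
    using R that unfolding edge_weight_def orbit_sum_D by blast
  have R_eq: "R x = R y" if x: "x \<in> carrier thompson_T" and y: "y \<in> carrier thompson_T"
    and "x (circ 0) = y (circ 0)" for x y
  proof -
    have "inverse_map x (x (circ 0)) = circ 0"
      using thompson_T_D(2)[OF x] by (simp add: bij_is_inj)
    then have "R (x \<circ> (inverse_map x \<circ> y)) = R x"
      using that by (intro F) (auto simp: thompson_T_inv thompson_T_compose)
    moreover have "x \<circ> (inverse_map x \<circ> y) = y"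
      using thompson_T_D(2)[OF x] by (simp add: fun_eq_iff bij_is_surj surj_f_inv_f)
    ultimately show ?thesis
      by simp
  qed
  define P where "P x \<longleftrightarrow> x \<in> carrier thompson_T \<and> (\<exists>t. 3/4 \<le> t \<and> t \<le> 1 \<and> x (circ 0) = circ t)" for x
  define s where "s x = R x + R (thompson_D \<circ> x)" for x
  have two: "2 \<le> u + 1 / u" if "0 < u" for u :: real
  proof -
    have "0 \<le> (u - 1)\<^sup>2 / u"
      using that by simp
    also have "\<dots> = u + 1 / u - 2"
      using that by (simp add: field_simps power2_eq_square)
    finally show ?thesis by simp
  qed
  have step: "\<exists>y. P y \<and> s x + \<delta> \<le> s y" if "P x" for x
  proof -
    obtain t where x: "x \<in> carrier thompson_T" and t: "3/4 \<le> t" "t \<le> 1" "x (circ 0) = circ t"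
      using \<open>P x\<close> by (auto simp: P_def)
    define h where "h = (if R (thompson_D \<circ> (thompson_D \<circ> x)) \<le> R (thompson_D \<circ> (thompson_D \<circ> (thompson_D \<circ> x)))
        then thompson_D \<circ> (thompson_D \<circ> x) else thompson_D \<circ> (thompson_D \<circ> (thompson_D \<circ> x)))"
    have h: "h \<in> carrier thompson_T"
      using x D by (simp add: h_def)
    have "\<exists>u. 0 \<le> u \<and> u \<le> 1/2 \<and> h (circ 0) = circ u"
    proof (cases "R (thompson_D \<circ> (thompson_D \<circ> x)) \<le> R (thompson_D \<circ> (thompson_D \<circ> (thompson_D \<circ> x)))")
      case True
      then show ?thesis
        using t by (intro exI[of _ "t - 1/2"]) (simp add: h_def thompson_D_circ)
    next
      case False
      then show ?thesis
        using t by (intro exI[of _ "t - 3/4"]) (simp add: h_def thompson_D_circ)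
    qed
    then obtain u where u: "0 \<le> u" "u \<le> 1/2" "h (circ 0) = circ u"
      by blast
    define y where "y = thompson_C \<circ> h"
    have y: "y \<in> carrier thompson_T" "y (circ 0) = circ (u / 2 + 3/4)"
      using h C u by (auto simp: y_def thompson_C_circ)
    have "P y"
      unfolding P_def using y u by (intro conjI exI[of _ "u / 2 + 3/4"]) auto
    have "R (thompson_C \<circ> y) = R (thompson_D \<circ> y)"
      by (rule R_eq) (use y u C D thompson_C_eq_D[of "u / 2 + 3/4"] in auto)
    then have 1: "1 / R h + 1 / R y + 1 / R (thompson_D \<circ> y) \<le> \<rho>"
      using RC[OF h] by (simp add: y_def)
    have 2: "s x + 2 * R h \<le> \<rho>"
      using RD[OF x] by (auto simp: h_def s_def)
    have "0 \<le> (sqrt 2 * R h - 1)\<^sup>2 / R h"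
      using pos[OF h] by simp
    also have "\<dots> = 2 * R h + 1 / R h - 2 * sqrt 2"
      using pos[OF h] by (simp add: field_simps power2_eq_square)
    finally have 3: "2 * sqrt 2 \<le> 2 * R h + 1 / R h"
      by simp
    have "s x + \<delta> \<le> s y"
      using 1 2 3 two[OF pos[OF y(1)]] two[OF pos[OF D[OF y(1)]]]
      by (simp add: \<delta>_def s_def)
    then show ?thesis
      using \<open>P y\<close> by blast
  qed
  have "\<exists>x. P x \<and> real n * \<delta> \<le> s x" for n
  proof (induction n)
    case 0
    have "P thompson_C"
      using thompson_C_in_T by (auto simp: P_def C_powers_at_0 intro!: exI[of _ "3/4"])
    moreover have "0 \<le> s thompson_C"
      using pos thompson_C_in_T D[OF thompson_C_in_T] by (simp add: s_def less_imp_le)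
    ultimately show ?case
      by auto
  next
    case (Suc n)
    then obtain x where x: "P x" "real n * \<delta> \<le> s x"
      by blast
    then obtain y where "P y" "s x + \<delta> \<le> s y"
      using step by blast
    then show ?case
      using x by (intro exI[of _ y]) (simp add: algebra_simps)
  qed
  moreover have "s x \<le> \<rho>" if "P x" for x
  proof -
    have x: "x \<in> carrier thompson_T"
      using that by (simp add: P_def)
    show ?thesis
      using RD[OF x] pos[OF D[OF D[OF x]]] pos[OF D[OF D[OF D[OF x]]]] by (simp add: s_def)
  qed
  ultimately have "real n * \<delta> \<le> \<rho>" for n
    by (meson order_trans)
  then show False
    using reals_Archimedean3[OF \<delta>] by (metis not_less)
qed

lemma amenable_bound:
  assumes "amenable thompson_F"
  shows "sqrt 12 * (2 + sqrt 2) \<le> T.prod_norm"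
proof (rule ccontr)
  define \<rho> where "\<rho> = T.prod_norm / sqrt 12"
  assume "\<not> sqrt 12 * (2 + sqrt 2) \<le> T.prod_norm"
  then have "\<rho> < 2 + sqrt 2"
    by (simp add: \<rho>_def field_simps)
  \<comment> \<open>Passing to a superharmonic pair costs \<open>\<delta>\<close> and averaging \<open>4 * \<delta>\<close>, which is less than \<open>6 * \<delta>\<close>
    together.\<close>
  define \<delta> where "\<delta> = (2 + sqrt 2 - \<rho>) / 6"
  have \<delta>: "0 < \<delta>"
    using \<open>\<rho> < 2 + sqrt 2\<close> by (simp add: \<delta>_def)
  have "T.prod_norm < sqrt (card C_powers * card D_powers) * (\<rho> + \<delta>)"
    using \<delta> by (simp add: \<rho>_def card_C_powers card_D_powers distrib_left)
  then obtain \<phi> \<psi> where "superharmonic_pair thompson_T C_powers D_powers (\<rho> + \<delta>) \<phi> \<psi>"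
    by (rule T.superharmonic_pair_exists)
  then have weight: "edge_weight thompson_T C_powers D_powers (\<rho> + \<delta>) (\<lambda>x. \<phi> x / \<psi> x)"
    by (rule T.superharmonic_pair_edge_weight)
  obtain R where "edge_weight thompson_T C_powers D_powers (\<rho> + \<delta> + card D_powers * \<delta>) R"
    "\<And>x h. x \<in> carrier thompson_T \<Longrightarrow> h \<in> {f \<in> carrier thompson_T. f (circ 0) = circ 0} \<Longrightarrow>
       R (x \<otimes>\<^bsub>thompson_T\<^esub> h) = R x"
    by (fact T.edge_weight_average[OF weight subgroup_F assms[unfolded thompson_F_def] \<delta>])
  then have "2 + sqrt 2 \<le> \<rho> + \<delta> + card D_powers * \<delta>"
    by (intro F_invariant_edge_weight_ge[of _ R]) auto
  moreover have "2 + sqrt 2 = \<rho> + 6 * \<delta>"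
    unfolding \<delta>_def by argo
  ultimately show False
    using \<delta> by (simp add: card_D_powers)
qed

theorem theorem1p2:
  fixes R (structure) and I C D :: "(circle \<Rightarrow> circle) \<Rightarrow> complex" and N :: real
  defines "R \<equiv> group_ring thompson_T"
    and "I \<equiv> group_elt \<one>\<^bsub>thompson_T\<^esub>"
    and "C \<equiv> group_elt thompson_C"
    and "D \<equiv> group_elt thompson_D"
    and "N \<equiv> group_ring_norm thompson_T
          ((I \<oplus> C \<oplus> C [^] (2::nat)) \<otimes> (I \<oplus> D \<oplus> D [^] (2::nat) \<oplus> D [^] (3::nat)))"
  shows "sqrt 2 + sqrt 3 < 1 / sqrt 12 * N \<and> 1 / sqrt 12 * N \<le> 2 + sqrt 2 \<and>
         (amenable thompson_F \<longrightarrow> 1 / sqrt 12 * N = 2 + sqrt 2)"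
proof -
  have N: "N = T.prod_norm"
    unfolding N_def I_def C_def D_def R_def T.prod_norm_def thompson_T_simps
      set_elt_C_powers set_elt_D_powers ..
  have upper: "N \<le> sqrt 12 * (2 + sqrt 2)"
    using T.prod_norm_le[OF half_weight_edge_weight] by (simp add: N card_C_powers card_D_powers)
  have lower: "sqrt 12 * (sqrt 2 + sqrt 3) < N"
    using free_product_bound by (simp add: N)
  have "N = sqrt 12 * (2 + sqrt 2)" if "amenable thompson_F"
    using amenable_bound[OF that] upper by (simp add: N)
  then show ?thesis
    using upper lower by (simp add: field_simps)
qed

end
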